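(* Let $n\ge 2$. For every fixed $u\in\mathbb{S}^n$, there is a one-to-one correspondence between $u$-projection covariant operations $*\colon\mathcal{K}_u^p(\mathbb{S}^n)\times\mathcal{K}_u^p(\mathbb{S}^n)\to\mathcal{K}_u^p(\mathbb{S}^n)$ and projection covariant operations $\overline{*}\colon\mathcal{K}(\mathbb{R}^n)\times\mathcal{K}(\mathbb{R}^n)\to\mathcal{K}(\mathbb{R}^n)$. Moreover, every such $u$-projection covariant operation $*$ is continuous in the Hausdorff metric.
   Context: $\mathbb{S}^n$ is the Euclidean unit sphere in $\mathbb{R}^{n+1}$ with spherical distance $d(u,v)=\arccos(u\cdot v)$. For $A\subseteq\mathbb{S}^n$ and $\lambda\ge0$, $A_\lambda$ is the set of all points of $\mathbb{S}^n$ at distance at most $\lambda$ from $A$. The Hausdorff distance between closed sets in $\mathbb{S}^n$ is $\delta_s(A,B)=\min\{0\le\lambda\le\pi: A\subseteq B_\lambda,\ B\subseteq A_\lambda\}$. A set $A\subseteq\mathbb{S}^n$ is (spherically) convex if $\mathrm{rad}\,A=\{\lambda x:\lambda\ge0,\ x\in A\}$ is convex in $\mathbb{R}^{n+1}$. A convex body in $\mathbb{S}^n$ is a nonempty closed convex subset. For $u\in\mathbb{S}^n$, $\mathcal{K}_u^p(\mathbb{S}^n)$ is the set of convex bodies contained in the open hemisphere $\{v\in\mathbb{S}^n:u\cdot v>0\}$, with metric $\delta_s$. For $0\le k\le n$, a $k$-sphere is $S=V\cap\mathbb{S}^n$ with $V\subseteq\mathbb{R}^{n+1}$ a $(k+1)$-dimensional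 linear subspace; the spherical projection is $K|S=(\mathrm{rad}(K)|V)\cap\mathbb{S}^n$, where $\mathrm{rad}(K)|V$ is the orthogonal projection onto $V$. An operation $*$ on $\mathcal{K}_u^p(\mathbb{S}^n)$ is $u$-projection covariant if $(K|S)*(L|S)=(K*L)|S$ for all $k$-spheres $S$, $0\le k\le n-1$, with $u\in S$ and all $K,L\in\mathcal{K}_u^p(\mathbb{S}^n)$. $\mathcal{K}(\mathbb{R}^n)$ is the space of nonempty compact convex sets in $\mathbb{R}^n$. An operation $\overline{*}$ on $\mathcal{K}(\mathbb{R}^n)$ is projection covariant if $(K|V)\,\overline{*}\,(L|V)=(K\,\overline{*}\,L)|V$ for every linear subspace $V$ of $\mathbb{R}^n$ and all $K,L\in\mathcal{K}(\mathbb{R}^n)$, where $|V$ is orthogonal projection onto $V$. *)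

theory Defs
  imports "HOL-Analysis.Analysis"
begin

text \<open>
  The unit sphere of dimension \<open>n\<close> is \<open>sphere 0 1\<close> in a Euclidean space of dimension \<open>n + 1\<close>.
\<close>

definition sdist :: "'a::euclidean_space \<Rightarrow> 'a \<Rightarrow> real" where
  "sdist u v = arccos (u \<bullet> v)"

definition sdist_set :: "'a::euclidean_space \<Rightarrow> 'a set \<Rightarrow> real" where
  "sdist_set v A = (INF a\<in>A. sdist v a)"

definition sphere_nbhd :: "'a::euclidean_space set \<Rightarrow> real \<Rightarrow> 'a set" where
  "sphere_nbhd A l = {v \<in> sphere 0 1. A \<noteq> {} \<and> sdist_set v A \<le> l}"

text \<open>
  The value 0 outside the nonempty subsets of the sphere is a convention; with it the locale
  \<^locale>\<open>Metric_space\<close>, which demands nonnegativity of the distance function on the whole type,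
  applies. On the nonempty subsets of the sphere the minimum exists, see \<open>sph_hausdorff_min\<close>.
\<close>

definition sph_hausdorff :: "'a::euclidean_space set \<Rightarrow> 'a set \<Rightarrow> real" where
  "sph_hausdorff A B =
    (if A \<noteq> {} \<and> B \<noteq> {} \<and> A \<subseteq> sphere 0 1 \<and> B \<subseteq> sphere 0 1
     then (LEAST l. 0 \<le> l \<and> l \<le> pi \<and> A \<subseteq> sphere_nbhd B l \<and> B \<subseteq> sphere_nbhd A l)
     else 0)"

definition rad :: "'a::euclidean_space set \<Rightarrow> 'a set" where
  "rad A = {l *\<^sub>R x | l x. 0 \<le> l \<and> x \<in> A}"

definition sph_convex :: "'a::euclidean_space set \<Rightarrow> bool" where
  "sph_convex A \<longleftrightarrow> A \<subseteq> sphere 0 1 \<and> convex (rad A)"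

definition sph_body :: "'a::euclidean_space set \<Rightarrow> bool" where
  "sph_body K \<longleftrightarrow> K \<noteq> {} \<and> closed K \<and> sph_convex K"

definition proper_bodies :: "'a::euclidean_space \<Rightarrow> 'a set set" where
  "proper_bodies u = {K. sph_body K \<and> K \<subseteq> {v \<in> sphere 0 1. u \<bullet> v > 0}}"

definition orth_proj :: "'a::euclidean_space set \<Rightarrow> 'a \<Rightarrow> 'a" where
  "orth_proj V x = (THE y. y \<in> V \<and> (\<forall>w\<in>V. orthogonal (x - y) w))"

definition k_sphere :: "nat \<Rightarrow> 'a::euclidean_space set \<Rightarrow> bool" where
  "k_sphere k S \<longleftrightarrow> (\<exists>V. subspace V \<and> dim V = k + 1 \<and> S = V \<inter> sphere 0 1)"

text \<open>The subspace \<open>V\<close> with \<open>S = V \<inter> sphere 0 1\<close> is \<open>span S\<close>, see \<open>span_sphere_section\<close>.\<close>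

definition sph_proj :: "'a::euclidean_space set \<Rightarrow> 'a set \<Rightarrow> 'a set" where
  "sph_proj K S = (orth_proj (span S) ` rad K) \<inter> sphere 0 1"

text \<open>
  Binary operations are extensional functions on pairs (\<open>undefined\<close> outside the given family of
  sets), so that distinct elements of the following sets are distinct operations. If
  \<open>DIM('a) = n + 1\<close>, then \<open>k + 1 < DIM('a)\<close> means \<open>k \<le> n - 1\<close>.
\<close>

definition sph_proj_covariant_ops ::
    "'a::euclidean_space \<Rightarrow> ('a set \<times> 'a set \<Rightarrow> 'a set) set" where
  "sph_proj_covariant_ops u =
    {f \<in> (proper_bodies u \<times> proper_bodies u) \<rightarrow>\<^sub>E proper_bodies u.
       \<forall>k S. k + 1 < DIM('a) \<and> k_sphere k S \<and> u \<in> S \<longrightarrow>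
         (\<forall>K\<in>proper_bodies u. \<forall>L\<in>proper_bodies u.
            f (sph_proj K S, sph_proj L S) = sph_proj (f (K, L)) S)}"

definition compact_convex_sets :: "'a::euclidean_space set set" where
  "compact_convex_sets = {K. K \<noteq> {} \<and> compact K \<and> convex K}"

definition proj_covariant_ops :: "('a::euclidean_space set \<times> 'a set \<Rightarrow> 'a set) set" where
  "proj_covariant_ops =
    {f \<in> (compact_convex_sets \<times> compact_convex_sets) \<rightarrow>\<^sub>E compact_convex_sets.
       \<forall>V. subspace V \<longrightarrow>
         (\<forall>K\<in>compact_convex_sets. \<forall>L\<in>compact_convex_sets.
            f (orth_proj V ` K, orth_proj V ` L) = orth_proj V ` f (K, L))}"

definition proper_bodies_topology :: "'a::euclidean_space \<Rightarrow> 'a set topology" where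
  "proper_bodies_topology u = Metric_space.mtopology (proper_bodies u) sph_hausdorff"

lemma span_sphere_section:
  fixes V :: "'a::euclidean_space set"
  assumes "subspace V"
  shows "span (V \<inter> sphere 0 1) = V"
proof
  show "span (V \<inter> sphere 0 1) \<subseteq> V"
    by (rule span_minimal) (use assms in auto)
  show "V \<subseteq> span (V \<inter> sphere 0 1)"
  proof
    fix x assume x: "x \<in> V"
    show "x \<in> span (V \<inter> sphere 0 1)"
    proof (cases "x = 0")
      case False
      have "(1 / norm x) *\<^sub>R x \<in> V \<inter> sphere 0 1"
        using False x assms by (auto intro: subspace_scale)
      then have "norm x *\<^sub>R ((1 / norm x) *\<^sub>R x) \<in> span (V \<inter> sphere 0 1)"
        by (intro span_scale span_base)
      then show ?thesis using False by simp
    qed (simp add: span_zero)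
  qed
qed

lemma orth_proj_eqI:
  fixes V :: "'a::euclidean_space set"
  assumes "subspace V" "y \<in> V" "\<And>w. w \<in> V \<Longrightarrow> orthogonal (x - y) w"
  shows "orth_proj V x = y"
  unfolding orth_proj_def
proof (rule the_equality)
  show "y \<in> V \<and> (\<forall>w\<in>V. orthogonal (x - y) w)" using assms by blast
next
  fix z assume z: "z \<in> V \<and> (\<forall>w\<in>V. orthogonal (x - z) w)"
  then have zy: "z - y \<in> V" using assms by (simp add: subspace_diff)
  have "orthogonal (x - y) (z - y)" "orthogonal (x - z) (z - y)"
    using zy z assms by auto
  then have "(z - y) \<bullet> (z - y) = 0"
    by (simp add: orthogonal_def inner_diff_left inner_diff_right inner_commute)
  then show "z = y" by simp
qed

lemma orth_proj:
  fixes V :: "'a::euclidean_space set"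
  assumes "subspace V"
  shows "orth_proj V x \<in> V \<and> (\<forall>w\<in>V. orthogonal (x - orth_proj V x) w)"
proof -
  obtain y z where yz: "y \<in> span V" "\<And>w. w \<in> span V \<Longrightarrow> orthogonal z w" "x = y + z"
    using orthogonal_subspace_decomp_exists[of V x] by metis
  have V: "span V = V" using assms by simp
  have "orth_proj V x = y"
    by (rule orth_proj_eqI) (use yz V assms in auto)
  then show ?thesis using yz V by auto
qed

lemma sdist_bounds:
  fixes u v :: "'a::euclidean_space"
  assumes "u \<in> sphere 0 1" "v \<in> sphere 0 1"
  shows "0 \<le> sdist u v" "sdist u v \<le> pi" "cos (sdist u v) = u \<bullet> v"
proof -
  have "\<bar>u \<bullet> v\<bar> \<le> 1" using Cauchy_Schwarz_ineq2[of u v] assms by simp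
  then have "-1 \<le> u \<bullet> v" "u \<bullet> v \<le> 1" by auto
  then show "0 \<le> sdist u v" "sdist u v \<le> pi" "cos (sdist u v) = u \<bullet> v"
    by (auto simp: sdist_def arccos_lbound arccos_ubound cos_arccos)
qed

lemma sdist_commute: "sdist u v = sdist v u"
  by (simp add: sdist_def inner_commute)

lemma sdist_refl: "u \<in> sphere 0 1 \<Longrightarrow> sdist u u = 0"
  by (simp add: sdist_def dot_square_norm)

lemma sdist_eq_0:
  assumes "u \<in> sphere 0 1" "v \<in> sphere 0 1" "sdist u v = 0"
  shows "u = v"
proof -
  have 1: "u \<bullet> v = 1" using sdist_bounds(3)[OF assms(1,2)] assms(3) by simp
  have "(u - v) \<bullet> (u - v) = u \<bullet> u + v \<bullet> v - 2 * (u \<bullet> v)"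
    by (simp add: inner_diff_left inner_diff_right inner_commute)
  also have "\<dots> = 0" using 1 assms by (simp add: dot_square_norm)
  finally show ?thesis by simp
qed

lemma sdist_triangle:
  fixes x y z :: "'a::euclidean_space"
  assumes "x \<in> sphere 0 1" "y \<in> sphere 0 1" "z \<in> sphere 0 1"
  shows "sdist x z \<le> sdist x y + sdist y z"
proof (cases "sdist x y + sdist y z \<le> pi")
  case True
  define a b where "a = sdist x y" and "b = sdist y z"
  note xy = sdist_bounds[OF assms(1,2)] and yz = sdist_bounds[OF assms(2,3)]
  have sq: "x \<bullet> x = 1" "y \<bullet> y = 1" "z \<bullet> z = 1"
    using assms by (auto simp: dot_square_norm)
  define x' z' where "x' = x - (x \<bullet> y) *\<^sub>R y" and "z' = z - (y \<bullet> z) *\<^sub>R y"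
  have nx: "norm x' = sin a"
  proof -
    have "(norm x')\<^sup>2 = 1 - (x \<bullet> y)\<^sup>2"
      unfolding x'_def power2_norm_eq_inner using sq
      by (simp add: inner_diff_left inner_diff_right inner_commute power2_eq_square)
    also have "\<dots> = (sin a)\<^sup>2"
      using xy(3) by (simp add: a_def sin_squared_eq)
    finally show ?thesis
      using xy sin_ge_zero[of a] by (simp add: a_def)
  qed
  have nz: "norm z' = sin b"
  proof -
    have "(norm z')\<^sup>2 = 1 - (y \<bullet> z)\<^sup>2"
      unfolding z'_def power2_norm_eq_inner using sq
      by (simp add: inner_diff_left inner_diff_right inner_commute power2_eq_square)
    also have "\<dots> = (sin b)\<^sup>2"
      using yz(3) by (simp add: b_def sin_squared_eq)
    finally show ?thesis
      using yz sin_ge_zero[of b] by (simp add: b_def)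
  qed
  have "x' \<bullet> z' = x \<bullet> z - (x \<bullet> y) * (y \<bullet> z)"
    unfolding x'_def z'_def using sq
    by (simp add: inner_diff_left inner_diff_right inner_commute)
  moreover have "- (norm x' * norm z') \<le> x' \<bullet> z'"
    using Cauchy_Schwarz_ineq2[of x' z'] by linarith
  ultimately have "cos (a + b) \<le> cos (sdist x z)"
    using xy(3) yz(3) sdist_bounds(3)[OF assms(1,3)] nx nz
    by (simp add: cos_add a_def b_def)
  then show ?thesis
    using cos_mono_le_eq[of "a + b" "sdist x z"] True xy yz sdist_bounds[OF assms(1,3)]
    by (simp add: a_def b_def)
next
  case False
  then show ?thesis using sdist_bounds(2)[OF assms(1,3)] by linarith
qed

lemma sdist_set_lower:
  assumes "v \<in> sphere 0 1" "A \<subseteq> sphere 0 1" "a \<in> A"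
  shows "sdist_set v A \<le> sdist v a"
  unfolding sdist_set_def
  by (rule cINF_lower) (use assms sdist_bounds(1)[OF assms(1)] in \<open>auto intro!: bdd_belowI2[of _ 0]\<close>)

lemma sdist_set_bounds:
  assumes "v \<in> sphere 0 1" "A \<subseteq> sphere 0 1" "A \<noteq> {}"
  shows "0 \<le> sdist_set v A" "sdist_set v A \<le> pi"
proof -
  show "0 \<le> sdist_set v A"
    unfolding sdist_set_def using assms sdist_bounds(1)[OF assms(1)]
    by (intro cINF_greatest) auto
  obtain a where "a \<in> A" using assms by auto
  then show "sdist_set v A \<le> pi"
    using sdist_set_lower[OF assms(1,2)] sdist_bounds(2)[OF assms(1), of a] assms(2) by force
qed

lemma sdist_set_triangle:
  assumes "v \<in> sphere 0 1" "w \<in> sphere 0 1" "A \<subseteq> sphere 0 1" "A \<noteq> {}"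
  shows "sdist_set v A \<le> sdist v w + sdist_set w A"
proof -
  have "sdist_set v A - sdist v w \<le> sdist w a" if "a \<in> A" for a
    using sdist_set_lower[OF assms(1,3) that] sdist_triangle[OF assms(1,2), of a] that assms(3)
    by force
  then have "sdist_set v A - sdist v w \<le> sdist_set w A"
    unfolding sdist_set_def[of w] by (intro cINF_greatest assms(4))
  then show ?thesis by simp
qed

lemma sph_hausdorff_min:
  fixes A B :: "'a::euclidean_space set"
  assumes A: "A \<subseteq> sphere 0 1" "A \<noteq> {}" and B: "B \<subseteq> sphere 0 1" "B \<noteq> {}"
  defines "D \<equiv> {l. 0 \<le> l \<and> l \<le> pi \<and> A \<subseteq> sphere_nbhd B l \<and> B \<subseteq> sphere_nbhd A l}"
  shows "sph_hausdorff A B \<in> D" "\<And>l. l \<in> D \<Longrightarrow> sph_hausdorff A B \<le> l"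
proof -
  define m where "m = max (SUP a\<in>A. sdist_set a B) (SUP b\<in>B. sdist_set b A)"
  have bA: "0 \<le> sdist_set a B \<and> sdist_set a B \<le> pi" if "a \<in> A" for a
    using sdist_set_bounds[OF _ B, of a] that A(1) by blast
  have bB: "0 \<le> sdist_set b A \<and> sdist_set b A \<le> pi" if "b \<in> B" for b
    using sdist_set_bounds[OF _ A, of b] that B(1) by blast
  have bdA: "bdd_above ((\<lambda>a. sdist_set a B) ` A)" using bA by (intro bdd_aboveI2[of _ _ pi]) auto
  have bdB: "bdd_above ((\<lambda>b. sdist_set b A) ` B)" using bB by (intro bdd_aboveI2[of _ _ pi]) auto
  have uA: "sdist_set a B \<le> m" if "a \<in> A" for a
    using cSUP_upper[OF that bdA] by (simp add: m_def)
  have uB: "sdist_set b A \<le> m" if "b \<in> B" for b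
    using cSUP_upper[OF that bdB] by (simp add: m_def)
  obtain a0 where "a0 \<in> A" using A by auto
  then have "0 \<le> m" using uA[of a0] bA[of a0] by linarith
  moreover have "m \<le> pi"
    unfolding m_def using bA bB A B by (auto intro!: cSUP_least)
  ultimately have mD: "m \<in> D"
    using uA uB A B by (auto simp: D_def sphere_nbhd_def)
  have least: "m \<le> l" if "l \<in> D" for l
    unfolding m_def using that A B by (auto simp: D_def sphere_nbhd_def intro!: cSUP_least)
  have "sph_hausdorff A B = (LEAST l. l \<in> D)"
    using A B by (simp add: sph_hausdorff_def D_def)
  also have "\<dots> = m" using mD least by (rule Least_equality)
  finally show "sph_hausdorff A B \<in> D" "\<And>l. l \<in> D \<Longrightarrow> sph_hausdorff A B \<le> l"
    using mD least by auto
qed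

lemma sph_hausdorff_commute: "sph_hausdorff A B = sph_hausdorff B A"
proof -
  have "(\<lambda>l. 0 \<le> l \<and> l \<le> pi \<and> A \<subseteq> sphere_nbhd B l \<and> B \<subseteq> sphere_nbhd A l) =
        (\<lambda>l. 0 \<le> l \<and> l \<le> pi \<and> B \<subseteq> sphere_nbhd A l \<and> A \<subseteq> sphere_nbhd B l)"
    by auto
  then show ?thesis unfolding sph_hausdorff_def by auto
qed

lemma sdist_set_eq_0:
  assumes "closed B" "B \<subseteq> sphere 0 1" "B \<noteq> {}" "a \<in> sphere 0 1" "sdist_set a B = 0"
  shows "a \<in> B"
proof -
  have "compact B"
    using assms by (meson bounded_sphere bounded_subset compact_eq_bounded_closed)
  moreover have "continuous_on B (\<lambda>b. sdist a b)"
    unfolding sdist_def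
  proof (intro continuous_on_arccos continuous_intros ballI)
    fix b assume "b \<in> B"
    then have "\<bar>a \<bullet> b\<bar> \<le> 1" using Cauchy_Schwarz_ineq2[of a b] assms by auto
    then show "-1 \<le> a \<bullet> b \<and> a \<bullet> b \<le> 1" by auto
  qed
  ultimately obtain b where b: "b \<in> B" "\<And>y. y \<in> B \<Longrightarrow> sdist a b \<le> sdist a y"
    using continuous_attains_inf[of B "\<lambda>b. sdist a b"] assms(3) by blast
  have "sdist a b \<le> sdist_set a B"
    unfolding sdist_set_def using b assms by (intro cINF_greatest) auto
  then have "sdist a b = 0"
    using assms sdist_bounds(1)[OF assms(4), of b] b by force
  then show ?thesis using sdist_eq_0[OF assms(4), of b] b assms by auto
qed

lemma Metric_space_proper_bodies: "Metric_space (proper_bodies u) sph_hausdorff"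
proof
  fix A B :: "'a set"
  show "0 \<le> sph_hausdorff A B"
    using sph_hausdorff_min(1)[of A B] by (cases "A \<noteq> {} \<and> B \<noteq> {} \<and> A \<subseteq> sphere 0 1 \<and> B \<subseteq> sphere 0 1")
      (auto simp: sph_hausdorff_def)
  show "sph_hausdorff A B = sph_hausdorff B A" by (rule sph_hausdorff_commute)
next
  fix A B assume AB: "A \<in> proper_bodies u" "B \<in> proper_bodies u"
  then have A: "A \<subseteq> sphere 0 1" "A \<noteq> {}" "closed A" and B: "B \<subseteq> sphere 0 1" "B \<noteq> {}" "closed B"
    by (auto simp: proper_bodies_def sph_body_def)
  note m = sph_hausdorff_min[OF A(1,2) B(1,2)]
  show "sph_hausdorff A B = 0 \<longleftrightarrow> A = B"
  proof
    assume "sph_hausdorff A B = 0"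
    then have 0: "A \<subseteq> sphere_nbhd B 0" "B \<subseteq> sphere_nbhd A 0" using m(1) by auto
    have "a \<in> B" if "a \<in> A" for a
      using sdist_set_eq_0[OF B(3,1,2), of a] sdist_set_bounds(1)[OF _ B(1,2), of a] that 0 A
      by (force simp: sphere_nbhd_def)
    moreover have "b \<in> A" if "b \<in> B" for b
      using sdist_set_eq_0[OF A(3,1,2), of b] sdist_set_bounds(1)[OF _ A(1,2), of b] that 0 B
      by (force simp: sphere_nbhd_def)
    ultimately show "A = B" by blast
  next
    assume eq: "A = B"
    have "sdist_set a A \<le> 0" if "a \<in> A" for a
      using sdist_set_lower[OF _ A(1) that, of a] sdist_refl[of a] that A(1) by auto
    then have "A \<subseteq> sphere_nbhd A 0" using A by (auto simp: sphere_nbhd_def)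
    then show "sph_hausdorff A B = 0" using m(1) m(2)[of 0] eq by auto
  qed
next
  fix A B C assume "A \<in> proper_bodies u" "B \<in> proper_bodies u" "C \<in> proper_bodies u"
  then have A: "A \<subseteq> sphere 0 1" "A \<noteq> {}" and B: "B \<subseteq> sphere 0 1" "B \<noteq> {}"
    and C: "C \<subseteq> sphere 0 1" "C \<noteq> {}"
    by (auto simp: proper_bodies_def sph_body_def)
  define l where "l = sph_hausdorff A B + sph_hausdorff B C"
  note AB = sph_hausdorff_min(1)[OF A B] and BC = sph_hausdorff_min(1)[OF B C]
    and AC = sph_hausdorff_min[OF A C]
  have step: "sdist_set x Z \<le> r + s"
    if "x \<in> sphere 0 1" "Y \<subseteq> sphere 0 1" "Y \<noteq> {}" "Z \<subseteq> sphere 0 1" "Z \<noteq> {}"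
      "sdist_set x Y \<le> r" "\<And>y. y \<in> Y \<Longrightarrow> sdist_set y Z \<le> s"
    for x :: 'a and Y Z r s
  proof -
    have "sdist_set x Z - s \<le> sdist x y" if "y \<in> Y" for y
      using sdist_set_triangle[of x y Z] that \<open>Y \<subseteq> sphere 0 1\<close> \<open>x \<in> sphere 0 1\<close>
        \<open>Z \<subseteq> sphere 0 1\<close> \<open>Z \<noteq> {}\<close> \<open>\<And>y. y \<in> Y \<Longrightarrow> sdist_set y Z \<le> s\<close>[OF that] by force
    then have "sdist_set x Z - s \<le> sdist_set x Y"
      unfolding sdist_set_def[of x Y] by (intro cINF_greatest \<open>Y \<noteq> {}\<close>)
    then show ?thesis using \<open>sdist_set x Y \<le> r\<close> by linarith
  qed
  show "sph_hausdorff A C \<le> sph_hausdorff A B + sph_hausdorff B C"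
  proof (cases "l \<le> pi")
    case True
    have "A \<subseteq> sphere_nbhd C l"
    proof
      fix a assume a: "a \<in> A"
      have "sdist_set a C \<le> sph_hausdorff A B + sph_hausdorff B C"
        by (rule step[of _ B]) (use a A B C AB BC in \<open>auto simp: sphere_nbhd_def\<close>)
      then show "a \<in> sphere_nbhd C l" using a A C by (auto simp: sphere_nbhd_def l_def)
    qed
    moreover have "C \<subseteq> sphere_nbhd A l"
    proof
      fix c assume c: "c \<in> C"
      have "sdist_set c A \<le> sph_hausdorff B C + sph_hausdorff A B"
        by (rule step[of _ B]) (use c A B C AB BC in \<open>auto simp: sphere_nbhd_def\<close>)
      then show "c \<in> sphere_nbhd A l" using c A C by (auto simp: sphere_nbhd_def l_def)
    qed
    moreover have "0 \<le> l" using AB BC by (auto simp: l_def)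
    ultimately show ?thesis using AC(2)[of l] True by (auto simp: l_def)
  next
    case False
    then show ?thesis using AC(1) by (auto simp: l_def)
  qed
qed

end

theory Submission
  imports Defs
begin

text \<open>
  Gnomonic projection from the centre maps the open hemisphere around \<open>u\<close> to the tangent hyperplane
  at \<open>u\<close>. It turns proper convex bodies into compact convex sets, and spherical projection onto a
  subspace through \<open>u\<close> into orthogonal projection, so conjugation with it is the bijection. (The full
  space is missing among the spheres, but projecting onto it is the identity.)

  Since it is a homeomorphism between the hemisphere and \<open>\<real>\<^sup>n\<close>, continuity reduces to the Euclidean
  case. Let \<open>f\<close> be projection covariant and \<open>h\<close> denote support functions. Projecting onto lines,
  and comparing lines through segments that project onto both of them, one gets
  \<open>h (f (K, L)) x = F (- h K (- x), h K x, - h L (- x), h L x)\<close> with one function \<open>F\<close> of two intervals for all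
  directions \<open>x\<close>; this uses \<open>n \<ge> 2\<close>. Rectangles realise any two pairs of intervals in orthogonal
  directions and their combinations in between, so \<open>F\<close> inherits sublinearity, and continuity along
  rays into the interior of its domain, from the sublinearity of \<open>h (f (K, L))\<close>. The domain is a
  polyhedral cone, so \<open>F\<close> is continuous up to its boundary, and hence \<open>f\<close> is continuous.
\<close>

section \<open>Elementary facts on orthogonal projection\<close>

lemma orth_proj_span_singleton:
  "orth_proj (span {x}) y = ((y \<bullet> x) / (x \<bullet> x)) *\<^sub>R x"
proof (rule orth_proj_eqI)
  show "subspace (span {x})" by simp
  show "((y \<bullet> x) / (x \<bullet> x)) *\<^sub>R x \<in> span {x}"
    by (simp add: span_base span_scale)
  show "orthogonal (y - ((y \<bullet> x) / (x \<bullet> x)) *\<^sub>R x) w" if "w \<in> span {x}" for w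
    using that by (cases "x = 0") (auto simp: span_singleton orthogonal_def inner_diff_left)
qed

lemma orth_proj_ident:
  assumes "subspace V" "x \<in> V"
  shows "orth_proj V x = x"
  by (rule orth_proj_eqI) (use assms in \<open>auto simp: orthogonal_def\<close>)

lemma orth_proj_scaleR:
  assumes "subspace V"
  shows "orth_proj V (c *\<^sub>R x) = c *\<^sub>R orth_proj V x"
proof (rule orth_proj_eqI)
  show "c *\<^sub>R orth_proj V x \<in> V"
    using assms orth_proj[OF assms, of x] by (simp add: subspace_scale)
  show "orthogonal (c *\<^sub>R x - c *\<^sub>R orth_proj V x) w" if "w \<in> V" for w
    using orth_proj[OF assms, of x] that
    by (simp add: orthogonal_def flip: scaleR_diff_right)
qed (use assms in auto)


section \<open>Support functions\<close>

definition supp_fun :: "'a::real_inner set \<Rightarrow> 'a \<Rightarrow> real" where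
  "supp_fun K x = (SUP k\<in>K. k \<bullet> x)"

definition lower_supp_fun :: "'a::real_inner set \<Rightarrow> 'a \<Rightarrow> real" where
  "lower_supp_fun K x = - supp_fun K (- x)"

lemma compact_convex_setsD:
  assumes "K \<in> compact_convex_sets"
  shows "K \<noteq> {}" "compact K" "convex K"
  using assms by (auto simp: compact_convex_sets_def)

lemma supp_fun_attained:
  assumes "K \<in> compact_convex_sets"
  obtains k where "k \<in> K" "supp_fun K x = k \<bullet> x" "\<And>y. y \<in> K \<Longrightarrow> y \<bullet> x \<le> k \<bullet> x"
proof -
  have "continuous_on K (\<lambda>k. k \<bullet> x)" by (intro continuous_intros)
  then obtain k where k: "k \<in> K" "\<And>y. y \<in> K \<Longrightarrow> y \<bullet> x \<le> k \<bullet> x"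
    using continuous_attains_sup[of K "\<lambda>k. k \<bullet> x"] compact_convex_setsD[OF assms] by blast
  then have "supp_fun K x = k \<bullet> x"
    unfolding supp_fun_def by (intro cSup_eq_maximum) auto
  with k that show ?thesis by blast
qed

lemma supp_fun_upper: "K \<in> compact_convex_sets \<Longrightarrow> k \<in> K \<Longrightarrow> k \<bullet> x \<le> supp_fun K x"
  by (metis supp_fun_attained)

lemma lower_supp_fun_lower: "K \<in> compact_convex_sets \<Longrightarrow> k \<in> K \<Longrightarrow> lower_supp_fun K x \<le> k \<bullet> x"
  using supp_fun_upper[of K k "- x"] by (simp add: lower_supp_fun_def)

lemma lower_supp_fun_le: "K \<in> compact_convex_sets \<Longrightarrow> lower_supp_fun K x \<le> supp_fun K x"
  by (metis supp_fun_attained lower_supp_fun_lower)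

text \<open>A linear functional maps a compact convex set to a compact connected subset of the
  reals, so its two extreme values determine the image. These are the data that projection to a line
  retains.\<close>

lemma inner_image_eq_interval:
  assumes "K \<in> compact_convex_sets"
  shows "(\<lambda>k. k \<bullet> x) ` K = {lower_supp_fun K x..supp_fun K x}"
proof
  show "(\<lambda>k. k \<bullet> x) ` K \<subseteq> {lower_supp_fun K x..supp_fun K x}"
    using supp_fun_upper lower_supp_fun_lower assms by auto
  obtain k where k: "k \<in> K" "supp_fun K x = k \<bullet> x" using supp_fun_attained[OF assms] by metis
  obtain l where l: "l \<in> K" "supp_fun K (- x) = l \<bullet> (- x)" using supp_fun_attained[OF assms] by metis
  have "is_interval ((\<lambda>k. k \<bullet> x) ` K)"
    unfolding is_interval_connected_1
    by (intro connected_continuous_image continuous_intros convex_connected compact_convex_setsD[OF assms])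
  moreover have "supp_fun K x \<in> (\<lambda>k. k \<bullet> x) ` K" "lower_supp_fun K x \<in> (\<lambda>k. k \<bullet> x) ` K"
    using k l by (auto simp: lower_supp_fun_def)
  ultimately show "{lower_supp_fun K x..supp_fun K x} \<subseteq> (\<lambda>k. k \<bullet> x) ` K"
    unfolding is_interval_1 by (meson atLeastAtMost_iff subsetI)
qed

lemma supp_fun_add_le:
  assumes "K \<in> compact_convex_sets"
  shows "supp_fun K (x + y) \<le> supp_fun K x + supp_fun K y"
  by (rule supp_fun_attained[OF assms, of "x + y"])
    (use supp_fun_upper[OF assms] in \<open>auto simp: inner_add_right intro: add_mono\<close>)

lemma supp_fun_scaleR:
  assumes "K \<in> compact_convex_sets" "0 \<le> r"
  shows "supp_fun K (r *\<^sub>R x) = r * supp_fun K x"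
proof (rule supp_fun_attained[OF assms(1), of x])
  fix k assume k: "k \<in> K" "supp_fun K x = k \<bullet> x" "\<And>y. y \<in> K \<Longrightarrow> y \<bullet> x \<le> k \<bullet> x"
  have "supp_fun K (r *\<^sub>R x) = r * (k \<bullet> x)"
    unfolding supp_fun_def
    by (rule cSup_eq_maximum) (use k assms(2) in \<open>auto intro: mult_left_mono\<close>)
  then show ?thesis using k by simp
qed

text \<open>
  For compact sets this says that the Hausdorff distance is at most \<open>r\<close>.
\<close>

definition hausdorff_le :: "real \<Rightarrow> 'a::metric_space set \<Rightarrow> 'a set \<Rightarrow> bool" where
  "hausdorff_le r A B \<longleftrightarrow> (\<forall>a\<in>A. \<exists>b\<in>B. dist a b \<le> r) \<and> (\<forall>b\<in>B. \<exists>a\<in>A. dist a b \<le> r)"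

lemma hausdorff_le_commute: "hausdorff_le r A B \<longleftrightarrow> hausdorff_le r B A"
  by (auto simp: hausdorff_le_def dist_commute)

text \<open>A maximiser in \<open>A\<close> has a point of \<open>B\<close> within \<open>r\<close>;
  by Cauchy-Schwarz the inner product with a unit vector changes by at most
  \<open>r\<close>.\<close>

lemma supp_fun_le_of_hausdorff_le:
  assumes "A \<in> compact_convex_sets" "B \<in> compact_convex_sets" "hausdorff_le r A B" "norm x = 1"
  shows "supp_fun A x \<le> supp_fun B x + r"
proof (rule supp_fun_attained[OF assms(1), of x])
  fix a assume a: "a \<in> A" "supp_fun A x = a \<bullet> x"
  obtain b where b: "b \<in> B" "dist a b \<le> r" using assms(3) a by (auto simp: hausdorff_le_def)
  have "a \<bullet> x - b \<bullet> x \<le> norm (a - b) * norm x"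
    by (metis inner_diff_left norm_cauchy_schwarz)
  then have "a \<bullet> x \<le> b \<bullet> x + r" using b assms(4) by (simp add: dist_norm)
  then show ?thesis using a supp_fun_upper[OF assms(2) b(1), of x] by linarith
qed

text \<open>The direction from the closest point \<open>b\<close> of \<open>B\<close> to
  \<open>a\<close> is an outer normal of \<open>B\<close> at \<open>b\<close>. In this direction the
  gap between \<open>a\<close> and the support function of \<open>B\<close> is exactly the distance
  of \<open>a\<close> from \<open>B\<close>.\<close>

lemma dist_le_of_supp_fun_le:
  assumes "A \<in> compact_convex_sets" "B \<in> compact_convex_sets" "0 \<le> r"
    and le: "\<And>x. norm x = 1 \<Longrightarrow> supp_fun A x \<le> supp_fun B x + r" and a: "a \<in> A"
  shows "\<exists>b\<in>B. dist a b \<le> r"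
proof -
  note B = compact_convex_setsD[OF assms(2)]
  define b where "b = closest_point B a"
  have b: "b \<in> B" unfolding b_def using B by (intro closest_point_in_set compact_imp_closed)
  have "dist a b \<le> r"
  proof (cases "a = b")
    case False
    define x where "x = (1 / norm (a - b)) *\<^sub>R (a - b)"
    have nx: "norm x = 1" using False by (simp add: x_def)
    obtain y where y: "y \<in> B" "supp_fun B x = y \<bullet> x" using supp_fun_attained[OF assms(2)] by metis
    have "(a - b) \<bullet> (y - b) \<le> 0"
      unfolding b_def using B y by (intro closest_point_dot compact_imp_closed) auto
    then have "y \<bullet> x \<le> b \<bullet> x"
      using False by (simp add: x_def inner_diff_right divide_right_mono inner_commute)
    moreover have "a \<bullet> x - b \<bullet> x = norm (a - b)"
      using False by (simp add: x_def divide_simps dot_square_norm power2_eq_square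
          flip: inner_diff_left)
    ultimately show ?thesis
      using supp_fun_upper[OF assms(1) a, of x] le[OF nx] y by (simp add: dist_norm)
  qed (use assms in auto)
  then show ?thesis using b by blast
qed

lemma hausdorff_leI:
  assumes "A \<in> compact_convex_sets" "B \<in> compact_convex_sets" "0 \<le> r"
    and "\<And>x. norm x = 1 \<Longrightarrow> \<bar>supp_fun A x - supp_fun B x\<bar> \<le> r"
  shows "hausdorff_le r A B"
proof -
  have "supp_fun A x \<le> supp_fun B x + r" "supp_fun B x \<le> supp_fun A x + r" if "norm x = 1" for x
    using assms(4)[OF that] by linarith+
  then show ?thesis
    using dist_le_of_supp_fun_le[OF assms(1,2,3)] dist_le_of_supp_fun_le[OF assms(2,1,3)]
    unfolding hausdorff_le_def by (metis dist_commute)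
qed


section \<open>Sublinear functions of two intervals\<close>

text \<open>A quadruple lists the ends of two intervals. In this encoding Minkowski addition and
  nonnegative scaling of intervals are the vector operations, and the admissible quadruples form a
  polyhedral cone.\<close>

definition interval_pairs :: "(real \<times> real \<times> real \<times> real) set" where
  "interval_pairs = {(a, b, c, d). a \<le> b \<and> c \<le> d}"

lemma closed_interval_pairs: "closed interval_pairs"
proof -
  have "interval_pairs = {p. fst p \<le> fst (snd p)} \<inter> {p. fst (snd (snd p)) \<le> snd (snd (snd p))}"
    by (auto simp: interval_pairs_def)
  moreover have "closed \<dots>"
    by (intro closed_Int closed_Collect_le continuous_intros)
  ultimately show ?thesis by simp
qed

lemma abs_le_norm_quadruple:
  fixes a b c d :: real
  shows "\<bar>a\<bar> \<le> norm (a, b, c, d)" "\<bar>b\<bar> \<le> norm (a, b, c, d)"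
    "\<bar>c\<bar> \<le> norm (a, b, c, d)" "\<bar>d\<bar> \<le> norm (a, b, c, d)"
  using norm_fst_le[of a "(b, c, d)"] norm_snd_le[where x = a and y = "(b, c, d)"]
    norm_fst_le[of b "(c, d)"] norm_snd_le[where x = b and y = "(c, d)"]
    norm_fst_le[of c d] norm_snd_le[where x = c and y = d] by auto

lemma norm_quadruple_le:
  fixes a b c d :: real
  assumes "\<bar>a\<bar> \<le> r" "\<bar>b\<bar> \<le> r" "\<bar>c\<bar> \<le> r" "\<bar>d\<bar> \<le> r"
  shows "norm (a, b, c, d) \<le> 4 * r"
  using norm_Pair_le[of a "(b, c, d)"] norm_Pair_le[of b "(c, d)"] norm_Pair_le[of c d] assms
  by (simp del: norm_Pair)

locale sublinear_on_intervals =
  fixes F :: "real \<times> real \<times> real \<times> real \<Rightarrow> real"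
  assumes add: "p \<in> interval_pairs \<Longrightarrow> q \<in> interval_pairs \<Longrightarrow> F (p + q) \<le> F p + F q"
    and scale: "p \<in> interval_pairs \<Longrightarrow> 0 < r \<Longrightarrow> F (r *\<^sub>R p) = r * F p"
begin

lemma at_zero: "F 0 = 0"
  using scale[of 0 2] by (simp add: interval_pairs_def zero_prod_def)

lemma scale0: "p \<in> interval_pairs \<Longrightarrow> 0 \<le> r \<Longrightarrow> F (r *\<^sub>R p) = r * F p"
  using scale[of p r] at_zero by (cases "r = 0") auto

text \<open>Six vectors generate the cone: for each interval two opposite translations and one that
  gives length. Sublinearity bounds \<open>F\<close> by its values there, with coefficients
  controlled by the norm.\<close>

lemma norm_bound: obtains C where "0 \<le> C" "\<And>p. p \<in> interval_pairs \<Longrightarrow> F p \<le> C * norm p"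
proof -
  let ?g = "[(1, 1, 0, 0), (-1, -1, 0, 0), (0, 1, 0, 0), (0, 0, 1, 1), (0, 0, -1, -1), (0, 0, 0, 1)]"
  define m where "m = Max ((\<lambda>p. \<bar>F p\<bar>) ` set ?g)"
  have m: "F p \<le> m" if "p \<in> set ?g" for p
  proof -
    have "\<bar>F p\<bar> \<le> m" unfolding m_def by (rule Max_ge) (use that in auto)
    then show ?thesis by linarith
  qed
  have m0: "0 \<le> m"
  proof -
    have "\<bar>F (1, 1, 0, 0)\<bar> \<le> m" unfolding m_def by (rule Max_ge) auto
    then show ?thesis by linarith
  qed
  have gen: "F (r *\<^sub>R p) \<le> r * m" if "p \<in> set ?g" "0 \<le> r" for r p
    using m[OF that(1)] scale0[of p r] that by (auto simp: interval_pairs_def mult_left_mono)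
  have const: "F (a, a, 0, 0) \<le> \<bar>a\<bar> * m" "F (0, 0, a, a) \<le> \<bar>a\<bar> * m" for a
    using gen[of "(1, 1, 0, 0)" "\<bar>a\<bar>"] gen[of "(-1, -1, 0, 0)" "\<bar>a\<bar>"]
      gen[of "(0, 0, 1, 1)" "\<bar>a\<bar>"] gen[of "(0, 0, -1, -1)" "\<bar>a\<bar>"]
    by (cases "0 \<le> a"; simp)+
  have "F p \<le> (6 * m) * norm p" if "p \<in> interval_pairs" for p
  proof -
    obtain a b c d where p: "p = (a, b, c, d)" "a \<le> b" "c \<le> d"
      using \<open>p \<in> interval_pairs\<close> by (auto simp: interval_pairs_def)
    have "F p = F (((a, a, 0, 0) + (b - a) *\<^sub>R (0, 1, 0, 0)) + ((0, 0, c, c) + (d - c) *\<^sub>R (0, 0, 0, 1)))"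
      by (simp add: p)
    also have "\<dots> \<le> F ((a, a, 0, 0) + (b - a) *\<^sub>R (0, 1, 0, 0)) + F ((0, 0, c, c) + (d - c) *\<^sub>R (0, 0, 0, 1))"
      by (rule add) (use p in \<open>auto simp: interval_pairs_def\<close>)
    also have "\<dots> \<le> (F (a, a, 0, 0) + F ((b - a) *\<^sub>R (0, 1, 0, 0))) + (F (0, 0, c, c) + F ((d - c) *\<^sub>R (0, 0, 0, 1)))"
      by (intro add_mono add) (use p in \<open>auto simp: interval_pairs_def\<close>)
    also have "\<dots> \<le> (\<bar>a\<bar> * m + (b - a) * m) + (\<bar>c\<bar> * m + (d - c) * m)"
      by (intro add_mono const gen) (use p in auto)
    also have "\<dots> = (\<bar>a\<bar> + (b - a) + \<bar>c\<bar> + (d - c)) * m" by (simp add: algebra_simps)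
    \<comment> \<open>Each of \<open>b - a\<close> and \<open>d - c\<close> is at most two norms,
      and \<open>\<bar>a\<bar>\<close>, \<open>\<bar>c\<bar>\<close> at most one each.\<close>
    also have "\<dots> \<le> (6 * norm p) * m"
      using abs_le_norm_quadruple[where a = a and b = b and c = c and d = d]
      by (intro mult_right_mono m0) (simp add: p)
    finally show ?thesis by (simp add: algebra_simps)
  qed
  then show ?thesis using that[of "6 * m"] m0 by simp
qed

text \<open>
  A sublinear function on a polyhedral cone is upper semicontinuous. Lower semicontinuity at a
  boundary point only has to be checked along one ray into the interior, because
  \<open>p + t *\<^sub>R (-1, 1, -1, 1) - q\<close> lies in the cone as soon as \<open>norm (q - p) \<le> t\<close>.
\<close>

lemma locally_Lipschitz:
  assumes p: "p \<in> interval_pairs"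
    and ray: "\<And>t. 0 \<le> t \<Longrightarrow> F p \<le> F (p + t *\<^sub>R (-1, 1, -1, 1)) + t * B"
  shows "\<exists>L \<delta>. 0 < \<delta> \<and> (\<forall>q\<in>interval_pairs. norm (q - p) < \<delta> \<longrightarrow> \<bar>F q - F p\<bar> \<le> L * norm (q - p))"
proof -
  obtain C where C: "0 \<le> C" "\<And>p. p \<in> interval_pairs \<Longrightarrow> F p \<le> C * norm p"
    using norm_bound by metis
  obtain a b c d where pe: "p = (a, b, c, d)" "a \<le> b" "c \<le> d"
    using p by (auto simp: interval_pairs_def)
  \<comment> \<open>Division by zero makes the summand of a degenerate interval vanish.\<close>
  define \<kappa> where "\<kappa> = 2 / (b - a) + 2 / (d - c)"
  have \<kappa>0: "0 \<le> \<kappa>" using pe by (simp add: \<kappa>_def)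
  have \<kappa>: "a < b \<Longrightarrow> 2 \<le> \<kappa> * (b - a)" "c < d \<Longrightarrow> 2 \<le> \<kappa> * (d - c)"
  proof -
    have "0 \<le> 2 / (b - a) * (d - c)" "0 \<le> 2 / (d - c) * (b - a)"
      using pe by (intro mult_nonneg_nonneg; simp)+
    moreover have "a < b \<Longrightarrow> 2 / (b - a) * (b - a) = 2" "c < d \<Longrightarrow> 2 / (d - c) * (d - c) = 2"
      by (simp_all add: field_simps)
    ultimately show "a < b \<Longrightarrow> 2 \<le> \<kappa> * (b - a)" "c < d \<Longrightarrow> 2 \<le> \<kappa> * (d - c)"
      by (simp_all only: \<kappa>_def distrib_right)
  qed
  define L where "L = max (3 * C + B) (\<kappa> * \<bar>F p\<bar> + C + C * \<kappa> * norm p)"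
  \<comment> \<open>The radius ensures \<open>\<kappa> * N < 1\<close>, which makes the shrinking
    factor \<open>r\<close> below positive.\<close>
  have "\<bar>F q - F p\<bar> \<le> L * norm (q - p)" if q: "q \<in> interval_pairs" and small: "norm (q - p) < 1 / (\<kappa> + 1)" for q
  proof -
    define N where "N = norm (q - p)"
    have N0: "0 \<le> N" by (simp add: N_def)
    obtain a' b' c' d' where qe: "q = (a', b', c', d')" "a' \<le> b'" "c' \<le> d'"
      using q by (auto simp: interval_pairs_def)
    have comp: "\<bar>a' - a\<bar> \<le> N" "\<bar>b' - b\<bar> \<le> N" "\<bar>c' - c\<bar> \<le> N" "\<bar>d' - d\<bar> \<le> N"
      using abs_le_norm_quadruple[where a = "a' - a" and b = "b' - b" and c = "c' - c" and d = "d' - d"]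
      by (auto simp: N_def pe qe)
    have \<kappa>N: "\<kappa> * N < 1"
    proof -
      have "(\<kappa> + 1) * N < 1" using small \<kappa>0 by (simp add: N_def field_simps)
      then show ?thesis using N0 by (simp add: algebra_simps)
    qed
    have lower: "F p \<le> F q + (3 * C + B) * N"
    proof -
      define v where "v = (-1::real, 1::real, -1::real, 1::real)"
      have nv: "norm v = 2" by (simp add: v_def norm_Pair)
      have mem: "p + N *\<^sub>R v - q \<in> interval_pairs"
        using comp by (auto simp: interval_pairs_def pe qe v_def)
      have "F p \<le> F (p + N *\<^sub>R v) + N * B" using ray[OF N0] by (simp add: v_def)
      also have "F (p + N *\<^sub>R v) \<le> F q + F (p + N *\<^sub>R v - q)"
        using add[OF q mem] by simp
      also have "F (p + N *\<^sub>R v - q) \<le> C * (3 * N)"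
      proof -
        have "norm (p + N *\<^sub>R v - q) \<le> norm (p - q) + norm (N *\<^sub>R v)"
          by (metis add_diff_eq add.commute norm_triangle_ineq diff_add_eq)
        then have "norm (p + N *\<^sub>R v - q) \<le> 3 * N"
          using N0 nv by (simp add: N_def norm_minus_commute)
        then show ?thesis using C(2)[OF mem] mult_left_mono[OF _ C(1)] by fastforce
      qed
      finally show ?thesis by (simp add: algebra_simps)
    qed
    have upper: "F q \<le> F p + (\<kappa> * \<bar>F p\<bar> + C + C * \<kappa> * norm p) * N"
    proof -
      \<comment> \<open>Shrinking \<open>p\<close> by \<open>r\<close> takes at least
        \<open>2 * N\<close> off each nondegenerate interval, the most that passing from
        \<open>p\<close> to \<open>q\<close> can remove. So \<open>q - r *\<^sub>R p\<close> stays
        in the cone and \<open>F q\<close> can be split along it.\<close>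
      define r where "r = 1 - \<kappa> * N"
      have r: "0 < r" using \<kappa>N by (simp add: r_def)
      have gap: "r * (b - a) \<le> b' - a'" if "a < b"
      proof -
        have "2 * N \<le> \<kappa> * (b - a) * N" using \<kappa>(1)[OF that] N0 by (rule mult_right_mono)
        then show ?thesis using comp by (simp add: r_def algebra_simps)
      qed
      have gap': "r * (d - c) \<le> d' - c'" if "c < d"
      proof -
        have "2 * N \<le> \<kappa> * (d - c) * N" using \<kappa>(2)[OF that] N0 by (rule mult_right_mono)
        then show ?thesis using comp by (simp add: r_def algebra_simps)
      qed
      \<comment> \<open>A degenerate interval of \<open>p\<close> still has length 0 after scaling,
        so there the order of the ends of \<open>q\<close> suffices.\<close>
      have mem: "q - r *\<^sub>R p \<in> interval_pairs"
        using gap gap' pe qe by (cases "a = b"; cases "c = d") (auto simp: interval_pairs_def algebra_simps)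
      have rp: "r *\<^sub>R p \<in> interval_pairs"
        using pe r by (auto simp: interval_pairs_def)
      have "F q \<le> F (r *\<^sub>R p) + F (q - r *\<^sub>R p)" using add[OF rp mem] by simp
      also have "F (r *\<^sub>R p) = r * F p" using scale[OF p r] .
      also have "F (q - r *\<^sub>R p) \<le> C * (N + \<kappa> * N * norm p)"
      proof -
        have "q - r *\<^sub>R p = (q - p) + (\<kappa> * N) *\<^sub>R p" by (simp add: r_def scaleR_diff_left)
        then have "norm (q - r *\<^sub>R p) \<le> N + \<kappa> * N * norm p"
          using norm_triangle_ineq[of "q - p" "(\<kappa> * N) *\<^sub>R p"] \<kappa>0 N0
          by (simp only: norm_scaleR abs_mult abs_of_nonneg flip: N_def)
        then show ?thesis using C(2)[OF mem] mult_left_mono[OF _ C(1)] by fastforce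
      qed
      also have "r * F p \<le> F p + \<kappa> * N * \<bar>F p\<bar>"
      proof -
        have "\<kappa> * N * (- F p) \<le> \<kappa> * N * \<bar>F p\<bar>" using \<kappa>0 N0 by (intro mult_left_mono) auto
        then show ?thesis by (simp add: r_def algebra_simps)
      qed
      finally show ?thesis by (simp add: algebra_simps)
    qed
    have "(3 * C + B) * N \<le> L * N" "(\<kappa> * \<bar>F p\<bar> + C + C * \<kappa> * norm p) * N \<le> L * N"
      using N0 by (auto simp: L_def intro!: mult_right_mono)
    then show ?thesis using lower upper by (simp add: N_def abs_le_iff)
  qed
  moreover have "0 < 1 / (\<kappa> + 1)" using \<kappa>0 by simp
  ultimately show ?thesis by blast
qed

lemma continuous_on_interval_pairs:
  assumes ray: "\<And>p. p \<in> interval_pairs \<Longrightarrow> \<exists>B. \<forall>t\<ge>0. F p \<le> F (p + t *\<^sub>R (-1, 1, -1, 1)) + t * B"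
  shows "continuous_on interval_pairs F"
  unfolding continuous_on_iff
proof (intro ballI allI impI)
  fix p and \<epsilon> :: real assume p: "p \<in> interval_pairs" and \<epsilon>: "0 < \<epsilon>"
  obtain B where B: "\<And>t. 0 \<le> t \<Longrightarrow> F p \<le> F (p + t *\<^sub>R (-1, 1, -1, 1)) + t * B"
    using ray[OF p] by blast
  obtain L \<delta> where L: "0 < \<delta>"
    "\<And>q. q \<in> interval_pairs \<Longrightarrow> norm (q - p) < \<delta> \<Longrightarrow> \<bar>F q - F p\<bar> \<le> L * norm (q - p)"
    using locally_Lipschitz[OF p B] by blast
  \<comment> \<open>The sign of \<open>L\<close> is not part of the Lipschitz statement;
    \<open>\<bar>L\<bar> + 1\<close> is a positive denominator in any case.\<close>
  define \<eta> where "\<eta> = min \<delta> (\<epsilon> / (\<bar>L\<bar> + 1))"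
  have "\<bar>F q - F p\<bar> < \<epsilon>" if q: "q \<in> interval_pairs" "norm (q - p) < \<eta>" for q
  proof -
    have "\<bar>F q - F p\<bar> \<le> L * norm (q - p)" using L(2) q by (simp add: \<eta>_def)
    also have "\<dots> \<le> (\<bar>L\<bar> + 1) * norm (q - p)" by (intro mult_right_mono) auto
    also have "\<dots> < \<epsilon>" using q(2) by (simp add: \<eta>_def field_simps)
    finally show ?thesis .
  qed
  moreover have "0 < \<eta>" using L(1) \<epsilon> by (simp add: \<eta>_def add_nonneg_pos)
  ultimately show "\<exists>d>0. \<forall>q\<in>interval_pairs. dist q p < d \<longrightarrow> dist (F q) (F p) < \<epsilon>"
    by (auto simp: dist_norm)
qed

end


section \<open>Projection covariant operations on compact convex sets\<close>

text \<open>The ends are coefficients of \<open>z\<close> and not lengths, so a projection changes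
  \<open>z\<close> alone and keeps \<open>a\<close> and \<open>b\<close>.\<close>

definition segment_on :: "'a::real_vector \<Rightarrow> real \<Rightarrow> real \<Rightarrow> 'a set" where
  "segment_on z a b = (\<lambda>t. t *\<^sub>R z) ` {a..b}"

definition rectangle_on :: "'a::real_vector \<Rightarrow> 'a \<Rightarrow> real \<times> real \<Rightarrow> real \<times> real \<Rightarrow> 'a set" where
  "rectangle_on e d I J = (\<lambda>(s, t). s *\<^sub>R e + t *\<^sub>R d) ` ({fst I..snd I} \<times> {fst J..snd J})"

lemma segment_on_compact_convex:
  fixes z :: "'a::euclidean_space"
  assumes "a \<le> b"
  shows "segment_on z a b \<in> compact_convex_sets"
proof -
  have "compact (segment_on z a b)" unfolding segment_on_def
    by (intro compact_continuous_image continuous_intros compact_Icc)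
  moreover have "convex (segment_on z a b)" unfolding segment_on_def
    by (intro convex_linear_image linearI) (auto simp: scaleR_left_distrib)
  ultimately show ?thesis using assms by (auto simp: compact_convex_sets_def segment_on_def)
qed

lemma orth_proj_image_segment_on:
  assumes "subspace V"
  shows "orth_proj V ` segment_on z a b = segment_on (orth_proj V z) a b"
  by (simp add: segment_on_def image_image orth_proj_scaleR[OF assms])

lemma rectangle_on_compact_convex:
  fixes e d :: "'a::euclidean_space"
  assumes "fst I \<le> snd I" "fst J \<le> snd J"
  shows "rectangle_on e d I J \<in> compact_convex_sets"
proof -
  have "compact (rectangle_on e d I J)" unfolding rectangle_on_def case_prod_unfold
    by (intro compact_continuous_image continuous_intros compact_Times compact_Icc)
  moreover have "linear (\<lambda>(s, t). s *\<^sub>R e + t *\<^sub>R d)"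
    by (rule linearI) (auto simp: algebra_simps)
  then have "convex (rectangle_on e d I J)" unfolding rectangle_on_def
    by (intro convex_linear_image convex_Times) auto
  ultimately show ?thesis using assms by (auto simp: compact_convex_sets_def rectangle_on_def)
qed

text \<open>The two coordinates of a rectangle vary independently, and with nonnegative weights the
  extremes add. Hence the interval seen in an intermediate direction is the combination of those
  seen along the sides.\<close>

lemma supp_fun_rectangle_on:
  assumes "norm e = 1" "norm d = 1" "e \<bullet> d = 0" "0 \<le> \<alpha>" "0 \<le> \<beta>"
    and "fst I \<le> snd I" "fst J \<le> snd J"
  shows "supp_fun (rectangle_on e d I J) (\<alpha> *\<^sub>R e + \<beta> *\<^sub>R d) = \<alpha> * snd I + \<beta> * snd J"
    and "lower_supp_fun (rectangle_on e d I J) (\<alpha> *\<^sub>R e + \<beta> *\<^sub>R d) = \<alpha> * fst I + \<beta> * fst J"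
proof -
  have ip: "e \<bullet> e = 1" "d \<bullet> d = 1" "d \<bullet> e = 0"
    using assms by (simp_all add: dot_square_norm inner_commute)
  have val: "(s *\<^sub>R e + t *\<^sub>R d) \<bullet> (\<alpha> *\<^sub>R e + \<beta> *\<^sub>R d) = \<alpha> * s + \<beta> * t" for s t
    using ip assms(3) by (simp add: inner_add_left inner_add_right)
  have im: "(\<lambda>k. k \<bullet> (\<alpha> *\<^sub>R e + \<beta> *\<^sub>R d)) ` rectangle_on e d I J =
      (\<lambda>(s, t). \<alpha> * s + \<beta> * t) ` ({fst I..snd I} \<times> {fst J..snd J})"
    unfolding rectangle_on_def image_image by (intro image_cong) (auto simp: val)
  show "supp_fun (rectangle_on e d I J) (\<alpha> *\<^sub>R e + \<beta> *\<^sub>R d) = \<alpha> * snd I + \<beta> * snd J"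
    unfolding supp_fun_def im
    by (intro cSup_eq_maximum) (use assms in \<open>auto intro!: add_mono mult_left_mono\<close>)
  have im': "(\<lambda>k. k \<bullet> (- (\<alpha> *\<^sub>R e + \<beta> *\<^sub>R d))) ` rectangle_on e d I J =
      (\<lambda>(s, t). - (\<alpha> * s + \<beta> * t)) ` ({fst I..snd I} \<times> {fst J..snd J})"
    unfolding rectangle_on_def image_image by (intro image_cong) (auto simp: val inner_minus_right simp del: minus_add_distrib)
  have "supp_fun (rectangle_on e d I J) (- (\<alpha> *\<^sub>R e + \<beta> *\<^sub>R d)) = - (\<alpha> * fst I + \<beta> * fst J)"
    unfolding supp_fun_def im'
  proof (rule cSup_eq_maximum)
    show "- (\<alpha> * fst I + \<beta> * fst J) \<in> (\<lambda>(s, t). - (\<alpha> * s + \<beta> * t)) ` ({fst I..snd I} \<times> {fst J..snd J})"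
      using assms by force
    show "x \<le> - (\<alpha> * fst I + \<beta> * fst J)"
      if x: "x \<in> (\<lambda>(s, t). - (\<alpha> * s + \<beta> * t)) ` ({fst I..snd I} \<times> {fst J..snd J})" for x
    proof -
      obtain s t where st: "x = - (\<alpha> * s + \<beta> * t)" "fst I \<le> s" "fst J \<le> t" using x by auto
      have "\<alpha> * fst I + \<beta> * fst J \<le> \<alpha> * s + \<beta> * t"
        using st assms by (intro add_mono mult_left_mono) auto
      then show ?thesis using st by simp
    qed
  qed
  then show "lower_supp_fun (rectangle_on e d I J) (\<alpha> *\<^sub>R e + \<beta> *\<^sub>R d) = \<alpha> * fst I + \<beta> * fst J"
    by (simp add: lower_supp_fun_def)
qed

section \<open>The function of two intervals behind a projection covariant operation\<close>

locale proj_covariant_op =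
  fixes f :: "'a::euclidean_space set \<times> 'a set \<Rightarrow> 'a set"
  assumes covariant: "f \<in> proj_covariant_ops" and dim_ge_2: "2 \<le> DIM('a)"
begin

lemma closed_op:
  "K \<in> compact_convex_sets \<Longrightarrow> L \<in> compact_convex_sets \<Longrightarrow> f (K, L) \<in> compact_convex_sets"
  using covariant by (auto simp: proj_covariant_ops_def)

lemma op_proj:
  "subspace V \<Longrightarrow> K \<in> compact_convex_sets \<Longrightarrow> L \<in> compact_convex_sets \<Longrightarrow>
    f (orth_proj V ` K, orth_proj V ` L) = orth_proj V ` f (K, L)"
  using covariant by (auto simp: proj_covariant_ops_def)

text \<open>The operation on intervals that \<open>f\<close> induces on the line of
  \<open>z\<close>, in coefficients of \<open>z\<close>.\<close>

definition coeffs :: "'a \<Rightarrow> real \<times> real \<times> real \<times> real \<Rightarrow> real set" where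
  "coeffs z = (\<lambda>(a, b, c, d). {t. t *\<^sub>R z \<in> f (segment_on z a b, segment_on z c d)})"

text \<open>Covariance under the projection to \<open>V\<close> carries the result for segments on
  \<open>z\<close> to the result for segments on \<open>w\<close> with the same ends. Since the
  former lies on the line of \<open>z\<close> and \<open>w \<noteq> 0\<close>, coefficients are
  preserved both ways.\<close>

lemma coeffs_proj:
  assumes V: "subspace V" and w: "orth_proj V z = w" "w \<noteq> 0" and p: "p \<in> interval_pairs"
  shows "coeffs z p = coeffs w p"
proof -
  obtain a b c d where pe: "p = (a, b, c, d)" "a \<le> b" "c \<le> d"
    using p by (auto simp: interval_pairs_def)
  define Z where "Z = f (segment_on z a b, segment_on z c d)"
  note segs = segment_on_compact_convex[OF pe(2)] segment_on_compact_convex[OF pe(3)]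
  \<comment> \<open>Both segments are fixed by projection to their own line; covariance therefore
    confines the result to that line.\<close>
  have "orth_proj (span {z}) ` Z = Z"
    unfolding Z_def by (subst op_proj[symmetric])
      (simp_all add: segs orth_proj_image_segment_on orth_proj_ident span_base)
  then have "Z \<subseteq> span {z}" using orth_proj[of "span {z}"] by (metis image_subsetI subspace_span)
  then have Zz: "\<exists>t. y = t *\<^sub>R z" if "y \<in> Z" for y using that by (auto simp: span_singleton)
  have W: "f (segment_on w a b, segment_on w c d) = orth_proj V ` Z"
    unfolding Z_def by (subst op_proj[OF V, symmetric])
      (simp_all add: segs orth_proj_image_segment_on V w)
  have "t *\<^sub>R w \<in> orth_proj V ` Z \<longleftrightarrow> t *\<^sub>R z \<in> Z" for t
  proof
    assume "t *\<^sub>R w \<in> orth_proj V ` Z"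
    then obtain y where y: "y \<in> Z" "t *\<^sub>R w = orth_proj V y" by auto
    then obtain s where "y = s *\<^sub>R z" using Zz by blast
    with y w show "t *\<^sub>R z \<in> Z" by (simp add: orth_proj_scaleR V)
  next
    assume "t *\<^sub>R z \<in> Z"
    then show "t *\<^sub>R w \<in> orth_proj V ` Z"
      by (rule rev_image_eqI) (simp add: orth_proj_scaleR V w)
  qed
  then show ?thesis by (simp add: coeffs_def pe W flip: Z_def)
qed

text \<open>Orthogonal \<open>x\<close> and \<open>y\<close> are both projections of
  \<open>x + y\<close>, so they have the same coefficients. Other pairs are linked through a vector
  orthogonal to \<open>x\<close>, which exists in dimension at least 2.\<close>

lemma coeffs_indep:
  assumes "x \<noteq> 0" "y \<noteq> 0" and p: "p \<in> interval_pairs"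
  shows "coeffs x p = coeffs y p"
proof -
  have ortho: "coeffs x p = coeffs y p" if "x \<noteq> 0" "y \<noteq> 0" "x \<bullet> y = 0" for x y
  proof -
    have "orth_proj (span {x}) (x + y) = x" "orth_proj (span {y}) (x + y) = y"
      using that inner_commute[of y x] by (simp_all add: orth_proj_span_singleton inner_add_left)
    then show ?thesis
      using coeffs_proj[of "span {x}" "x + y" x p] coeffs_proj[of "span {y}" "x + y" y p] that p
      by simp
  qed
  show ?thesis
  proof (cases "x \<bullet> y = 0")
    case False
    define r where "r = (y \<bullet> x) / (x \<bullet> x)"
    have r: "r \<noteq> 0" using False assms by (simp add: r_def inner_commute)
    obtain z where z: "z \<noteq> 0" "orthogonal x z"
      using orthogonal_to_vector_exists[OF dim_ge_2] by metis
    \<comment> \<open>Projecting \<open>y\<close> to the line of \<open>x\<close> gives only a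
      multiple of \<open>x\<close>; the detour through \<open>z\<close>, orthogonal to
      \<open>x\<close> and its multiples, removes the factor.\<close>
    have "coeffs y p = coeffs (r *\<^sub>R x) p"
      by (rule coeffs_proj[of "span {x}"]) (use r assms in \<open>auto simp: orth_proj_span_singleton r_def\<close>)
    also have "\<dots> = coeffs z p"
      by (rule ortho) (use z r assms in \<open>auto simp: orthogonal_def\<close>)
    also have "\<dots> = coeffs x p"
      by (rule ortho) (use z r assms in \<open>auto simp: orthogonal_def inner_commute\<close>)
    finally show ?thesis by simp
  qed (use assms ortho in auto)
qed

text \<open>This is the function \<open>F\<close> of the overview. By \<open>coeffs_indep\<close>
  the basis vector is an arbitrary choice of direction.\<close>

definition supp_coeff :: "real \<times> real \<times> real \<times> real \<Rightarrow> real" where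
  "supp_coeff p = Sup (coeffs (SOME i. i \<in> Basis) p)"

text \<open>Projection to the line of \<open>x\<close> commutes with \<open>f\<close> and turns both
  bodies into segments whose ends are the extreme inner products with \<open>x\<close>. The passage
  to a fixed basis vector is \<open>coeffs_indep\<close>.\<close>

lemma supp_fun_op:
  assumes K: "K \<in> compact_convex_sets" and L: "L \<in> compact_convex_sets" and x: "x \<noteq> 0"
  shows "supp_fun (f (K, L)) x =
    supp_coeff (lower_supp_fun K x, supp_fun K x, lower_supp_fun L x, supp_fun L x)"
    (is "_ = supp_coeff ?p")
proof -
  \<comment> \<open>With this scaling, \<open>k \<bullet> x\<close> is the coefficient of the projection of \<open>k\<close> onto the line of \<open>z\<close>.\<close>
  define z where "z = (1 / (x \<bullet> x)) *\<^sub>R x"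
  have z: "z \<noteq> 0" using x by (simp add: z_def)
  have proj: "orth_proj (span {z}) k = (k \<bullet> x) *\<^sub>R z" for k
    using x by (simp add: orth_proj_span_singleton z_def)
  have seg: "orth_proj (span {z}) ` M = segment_on z (lower_supp_fun M x) (supp_fun M x)"
    if "M \<in> compact_convex_sets" for M
    unfolding segment_on_def proj inner_image_eq_interval[OF that, symmetric] by (simp add: image_image)
  have "coeffs z ?p = {t. t *\<^sub>R z \<in> orth_proj (span {z}) ` f (K, L)}"
    by (simp add: coeffs_def K L seg flip: op_proj)
  also have "\<dots> = (\<lambda>k. k \<bullet> x) ` f (K, L)"
    using z by (auto simp: proj)
  finally have "(\<lambda>k. k \<bullet> x) ` f (K, L) = coeffs z ?p" by simp
  also have "\<dots> = coeffs (SOME i. i \<in> Basis) ?p"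
  proof (rule coeffs_indep[OF z])
    show "(SOME i. i \<in> Basis) \<noteq> (0::'a)" by (simp add: nonzero_Basis SOME_Basis)
    show "?p \<in> interval_pairs" by (simp add: interval_pairs_def lower_supp_fun_le K L)
  qed
  finally show ?thesis by (simp add: supp_fun_def supp_coeff_def)
qed

lemma orthonormal_pair: obtains e d :: 'a where "norm e = 1" "norm d = 1" "e \<bullet> d = 0"
proof -
  obtain e :: 'a where e: "norm e = 1" using vector_choose_size[of 1] by auto
  obtain d where d: "d \<noteq> 0" "orthogonal e d" using orthogonal_to_vector_exists[OF dim_ge_2] by metis
  show ?thesis using that[of e "(1 / norm d) *\<^sub>R d"] e d by (simp add: orthogonal_def)
qed

text \<open>One body realises \<open>supp_coeff\<close> on all nonnegative combinations of
  \<open>p\<close> and \<open>q\<close> as a support function on a quadrant, so properties of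
  support functions transfer to \<open>supp_coeff\<close>.\<close>

lemma supp_coeff_combine:
  assumes "p \<in> interval_pairs" "q \<in> interval_pairs"
  obtains M and e e' :: 'a where "M \<in> compact_convex_sets"
    "\<And>\<alpha> \<beta>. 0 \<le> \<alpha> \<Longrightarrow> 0 \<le> \<beta> \<Longrightarrow> (\<alpha>, \<beta>) \<noteq> (0, 0) \<Longrightarrow>
      supp_fun M (\<alpha> *\<^sub>R e + \<beta> *\<^sub>R e') = supp_coeff (\<alpha> *\<^sub>R p + \<beta> *\<^sub>R q)"
proof -
  obtain a b c d where p: "p = (a, b, c, d)" by (cases p)
  obtain a' b' c' d' where q: "q = (a', b', c', d')" by (cases q)
  obtain e e' :: 'a where e: "norm e = 1" "norm e' = 1" "e \<bullet> e' = 0" by (rule orthonormal_pair)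
  \<comment> \<open>The sides along \<open>e\<close> come from \<open>p\<close>, those along
    \<open>e'\<close> from \<open>q\<close>; so the pair \<open>K\<close>, \<open>L\<close> shows
    the data \<open>p\<close> in direction \<open>e\<close> and \<open>q\<close> in direction
    \<open>e'\<close>.\<close>
  define K where "K = rectangle_on e e' (a, b) (a', b')"
  define L where "L = rectangle_on e e' (c, d) (c', d')"
  have KL: "K \<in> compact_convex_sets" "L \<in> compact_convex_sets"
    using assms by (auto simp: p q K_def L_def interval_pairs_def intro!: rectangle_on_compact_convex)
  show ?thesis
  proof (rule that[of "f (K, L)" e e'])
    show "f (K, L) \<in> compact_convex_sets" by (rule closed_op[OF KL])
    fix \<alpha> \<beta> :: real assume ab: "0 \<le> \<alpha>" "0 \<le> \<beta>" "(\<alpha>, \<beta>) \<noteq> (0, 0)"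
    have "(\<alpha> *\<^sub>R e + \<beta> *\<^sub>R e') \<bullet> e = \<alpha>" "(\<alpha> *\<^sub>R e + \<beta> *\<^sub>R e') \<bullet> e' = \<beta>"
      using e inner_commute[of e' e] by (simp_all add: inner_add_left dot_square_norm)
    then have nz: "\<alpha> *\<^sub>R e + \<beta> *\<^sub>R e' \<noteq> 0" using ab by force
    show "supp_fun (f (K, L)) (\<alpha> *\<^sub>R e + \<beta> *\<^sub>R e') =
        supp_coeff (\<alpha> *\<^sub>R p + \<beta> *\<^sub>R q)"
      unfolding supp_fun_op[OF KL nz] using assms ab
      by (simp add: p q K_def L_def supp_fun_rectangle_on[OF e] interval_pairs_def)
  qed
qed

text \<open>Subadditivity is read off at \<open>e\<close>, \<open>e'\<close> and
  \<open>e + e'\<close>, homogeneity at \<open>e\<close> and \<open>r *\<^sub>R e\<close>.\<close>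

sublocale sublinear_on_intervals supp_coeff
proof
  fix p q assume p: "p \<in> interval_pairs" and q: "q \<in> interval_pairs"
  obtain M and e e' :: 'a where M: "M \<in> compact_convex_sets"
    "\<And>\<alpha> \<beta>. 0 \<le> \<alpha> \<Longrightarrow> 0 \<le> \<beta> \<Longrightarrow> (\<alpha>, \<beta>) \<noteq> (0, 0) \<Longrightarrow>
      supp_fun M (\<alpha> *\<^sub>R e + \<beta> *\<^sub>R e') = supp_coeff (\<alpha> *\<^sub>R p + \<beta> *\<^sub>R q)"
    by (rule supp_coeff_combine[OF p q]) (rule that)
  show "supp_coeff (p + q) \<le> supp_coeff p + supp_coeff q"
    using M(2)[of 1 1] M(2)[of 1 0] M(2)[of 0 1] supp_fun_add_le[OF M(1), of e e'] by simp
next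
  fix p and r :: real assume p: "p \<in> interval_pairs" and r: "0 < r"
  obtain M and e e' :: 'a where M: "M \<in> compact_convex_sets"
    "\<And>\<alpha> \<beta>. 0 \<le> \<alpha> \<Longrightarrow> 0 \<le> \<beta> \<Longrightarrow> (\<alpha>, \<beta>) \<noteq> (0, 0) \<Longrightarrow>
      supp_fun M (\<alpha> *\<^sub>R e + \<beta> *\<^sub>R e') = supp_coeff (\<alpha> *\<^sub>R p + \<beta> *\<^sub>R p)"
    by (rule supp_coeff_combine[OF p p]) (rule that)
  show "supp_coeff (r *\<^sub>R p) = r * supp_coeff p"
    using M(2)[of r 0] M(2)[of 1 0] supp_fun_scaleR[OF M(1), of r e] r by simp
qed

text \<open>With \<open>(-1, 1, -1, 1)\<close> as second partner, writing \<open>e\<close> as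
  \<open>(e + t *\<^sub>R e') + t *\<^sub>R (- e')\<close> gives the ray condition; its constant is
  \<open>supp_fun M (- e')\<close>, which does not depend on \<open>t\<close>.\<close>

lemma continuous_on_supp_coeff: "continuous_on interval_pairs supp_coeff"
proof (rule continuous_on_interval_pairs)
  fix p assume p: "p \<in> interval_pairs"
  have q: "(-1, 1, -1, 1) \<in> interval_pairs" by (simp add: interval_pairs_def)
  obtain M and e e' :: 'a where M: "M \<in> compact_convex_sets"
    "\<And>\<alpha> \<beta>. 0 \<le> \<alpha> \<Longrightarrow> 0 \<le> \<beta> \<Longrightarrow> (\<alpha>, \<beta>) \<noteq> (0, 0) \<Longrightarrow>
      supp_fun M (\<alpha> *\<^sub>R e + \<beta> *\<^sub>R e') = supp_coeff (\<alpha> *\<^sub>R p + \<beta> *\<^sub>R (-1, 1, -1, 1))"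
    by (rule supp_coeff_combine[OF p q]) (rule that)
  have "supp_coeff p \<le> supp_coeff (p + t *\<^sub>R (-1, 1, -1, 1)) + t * supp_fun M (- e')" if "0 \<le> t" for t
    using M(2)[of 1 0] M(2)[of 1 t] that supp_fun_add_le[OF M(1), of "e + t *\<^sub>R e'" "t *\<^sub>R (- e')"]
      supp_fun_scaleR[OF M(1), of t "- e'"] by (simp del: scaleR_Pair)
  then show "\<exists>B. \<forall>t\<ge>0. supp_coeff p \<le> supp_coeff (p + t *\<^sub>R (-1, 1, -1, 1)) + t * B" by blast
qed

text \<open>Close bodies have close quadruples, uniformly over unit directions. On a compact part of
  the cone \<open>supp_coeff\<close> is uniformly continuous, so the support functions of the
  results are uniformly close.\<close>

lemma op_continuous:
  assumes A: "A \<in> compact_convex_sets" and B: "B \<in> compact_convex_sets" and \<epsilon>: "0 < \<epsilon>"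
  shows "\<exists>\<delta>>0. \<forall>A'\<in>compact_convex_sets. \<forall>B'\<in>compact_convex_sets.
    hausdorff_le \<delta> A A' \<longrightarrow> hausdorff_le \<delta> B B' \<longrightarrow> hausdorff_le \<epsilon> (f (A, B)) (f (A', B'))"
proof -
  define data where "data A B x = (lower_supp_fun A x, supp_fun A x, lower_supp_fun B x, supp_fun B x)"
    for A B and x :: 'a
  have "bounded (A \<union> B)" using A B by (simp add: compact_convex_setsD compact_imp_bounded)
  then obtain R where R: "\<And>y. y \<in> A \<union> B \<Longrightarrow> norm y \<le> R" unfolding bounded_iff by blast
  have supp_le: "\<bar>supp_fun K x\<bar> \<le> R" if K: "K \<in> {A, B}" and x: "norm x = 1" for K x
  proof -
    have "K \<in> compact_convex_sets" using K A B by auto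
    then obtain k where k: "k \<in> K" "supp_fun K x = k \<bullet> x" by (rule supp_fun_attained)
    then show ?thesis using R[of k] K x Cauchy_Schwarz_ineq2[of k x] by auto
  qed
  \<comment> \<open>As \<open>\<delta> \<le> 1\<close>, the entries for the perturbed bodies are at
    most \<open>R + 1\<close>; the factor 4 is that of \<open>norm_quadruple_le\<close>.\<close>
  let ?C = "interval_pairs \<inter> cball 0 (4 * R + 4)"
  have "uniformly_continuous_on ?C supp_coeff"
    by (intro compact_uniformly_continuous closed_Int_compact closed_interval_pairs compact_cball
        continuous_on_subset[OF continuous_on_supp_coeff]) auto
  then obtain \<eta> where \<eta>: "0 < \<eta>" "\<And>p q. p \<in> ?C \<Longrightarrow> q \<in> ?C \<Longrightarrow> dist p q < \<eta> \<Longrightarrow>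
      dist (supp_coeff p) (supp_coeff q) < \<epsilon>"
    using \<epsilon> unfolding uniformly_continuous_on_def by metis
  define \<delta> where "\<delta> = min 1 (\<eta> / 5)"
  have \<delta>: "0 < \<delta>" "\<delta> \<le> 1" "4 * \<delta> < \<eta>" using \<eta> by (auto simp: \<delta>_def)
  have "hausdorff_le \<epsilon> (f (A, B)) (f (A', B'))"
    if A': "A' \<in> compact_convex_sets" and B': "B' \<in> compact_convex_sets"
      and near: "hausdorff_le \<delta> A A'" "hausdorff_le \<delta> B B'" for A' B'
  proof (rule hausdorff_leI)
    fix x :: 'a assume x: "norm x = 1"
    then have x0: "x \<noteq> 0" by auto
    have diff: "\<bar>supp_fun K y - supp_fun K' y\<bar> \<le> \<delta>"
      if "K \<in> compact_convex_sets" "K' \<in> compact_convex_sets" "hausdorff_le \<delta> K K'" "norm y = 1"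
      for K K' and y :: 'a
      using supp_fun_le_of_hausdorff_le[of K K' \<delta> y] supp_fun_le_of_hausdorff_le[of K' K \<delta> y] that
      by (simp add: hausdorff_le_commute abs_le_iff)
    have close: "\<bar>supp_fun A x - supp_fun A' x\<bar> \<le> \<delta>" "\<bar>supp_fun B x - supp_fun B' x\<bar> \<le> \<delta>"
      "\<bar>lower_supp_fun A x - lower_supp_fun A' x\<bar> \<le> \<delta>" "\<bar>lower_supp_fun B x - lower_supp_fun B' x\<bar> \<le> \<delta>"
      using diff[OF A A' near(1)] diff[OF B B' near(2)] x
      by (auto simp: lower_supp_fun_def abs_minus_commute)
    have bd: "\<bar>supp_fun A x\<bar> \<le> R" "\<bar>supp_fun B x\<bar> \<le> R"
      "\<bar>lower_supp_fun A x\<bar> \<le> R" "\<bar>lower_supp_fun B x\<bar> \<le> R"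
      using supp_le[of A] supp_le[of B] x by (auto simp: lower_supp_fun_def)
    have step: "\<bar>t\<bar> \<le> R + 1" if "\<bar>s\<bar> \<le> R" "\<bar>s - t\<bar> \<le> \<delta>" for s t
      using that \<delta>(2) by linarith
    have bd': "\<bar>supp_fun A' x\<bar> \<le> R + 1" "\<bar>supp_fun B' x\<bar> \<le> R + 1"
      "\<bar>lower_supp_fun A' x\<bar> \<le> R + 1" "\<bar>lower_supp_fun B' x\<bar> \<le> R + 1"
      by (rule step, rule bd, rule close)+
    have mem: "data A B x \<in> ?C" "data A' B' x \<in> ?C"
      using norm_quadruple_le[OF bd(3,1,4,2)] norm_quadruple_le[OF bd'(3,1,4,2)]
      by (simp_all add: data_def interval_pairs_def lower_supp_fun_le A A' B B')
    have "dist (data A B x) (data A' B' x) \<le> 4 * \<delta>"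
      using norm_quadruple_le[OF close(3,1,4,2)] by (simp add: data_def dist_norm)
    then have "dist (supp_coeff (data A B x)) (supp_coeff (data A' B' x)) < \<epsilon>"
      using \<eta>(2)[OF mem] \<delta>(3) by linarith
    then show "\<bar>supp_fun (f (A, B)) x - supp_fun (f (A', B')) x\<bar> \<le> \<epsilon>"
      by (simp add: supp_fun_op[OF A B x0] supp_fun_op[OF A' B' x0] data_def dist_real_def)
  qed (use A B A' B' \<epsilon> closed_op in auto)
  then show ?thesis using \<delta>(1) by blast
qed

end


section \<open>Spherical distance\<close>

lemma dist_sphere_eq:
  assumes "a \<in> sphere 0 1" "b \<in> sphere 0 1"
  shows "(dist a b)\<^sup>2 = 2 - 2 * cos (sdist a b)"
proof -
  have "a \<bullet> a = 1" "b \<bullet> b = 1" using assms by (auto simp: dot_square_norm)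
  then have "(dist a b)\<^sup>2 = 2 - 2 * (a \<bullet> b)"
    by (simp add: dist_norm power2_norm_eq_inner inner_diff_left inner_diff_right inner_commute)
  then show ?thesis using sdist_bounds(3)[OF assms] by simp
qed

text \<open>The chord is twice the sine of half the angle.\<close>

lemma dist_le_sdist:
  assumes "a \<in> sphere 0 1" "b \<in> sphere 0 1"
  shows "dist a b \<le> sdist a b"
proof -
  define t where "t = sdist a b / 2"
  have t: "0 \<le> t" using sdist_bounds[OF assms] by (simp add: t_def)
  have "(dist a b)\<^sup>2 = (2 * sin t)\<^sup>2"
    using dist_sphere_eq[OF assms] cos_double_sin[of t] by (simp add: t_def power_mult_distrib)
  also have "\<dots> \<le> (2 * t)\<^sup>2"
    using abs_sin_x_le_abs_x[of t] by (simp add: abs_le_square_iff[symmetric])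
  finally show ?thesis using t power2_le_imp_le[of "dist a b" "2 * t"] by (simp add: t_def)
qed

lemma sdist_small:
  assumes "0 < \<epsilon>"
  obtains \<eta> where "0 < \<eta>"
    "\<And>a b. a \<in> sphere 0 1 \<Longrightarrow> b \<in> sphere 0 1 \<Longrightarrow> dist a b < \<eta> \<Longrightarrow> sdist a b < \<epsilon>"
proof
  \<comment> \<open>The cap at \<open>pi\<close> keeps the angle in the range where the cosine
    decreases strictly, so that a chord bound becomes an angle bound.\<close>
  define \<epsilon>0 where "\<epsilon>0 = min \<epsilon> pi"
  have \<epsilon>0: "0 < \<epsilon>0" "\<epsilon>0 \<le> pi" "\<epsilon>0 \<le> \<epsilon>" using assms by (auto simp: \<epsilon>0_def)
  have pos: "0 < 2 - 2 * cos \<epsilon>0" using cos_monotone_0_pi[of 0 \<epsilon>0] \<epsilon>0 by simp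
  then show "0 < sqrt (2 - 2 * cos \<epsilon>0)" by simp
  fix a b :: 'a
  assume ab: "a \<in> sphere 0 1" "b \<in> sphere 0 1" and less: "dist a b < sqrt (2 - 2 * cos \<epsilon>0)"
  have "(dist a b)\<^sup>2 < (sqrt (2 - 2 * cos \<epsilon>0))\<^sup>2"
    using less by (intro power_strict_mono) auto
  then have "2 - 2 * cos (sdist a b) < 2 - 2 * cos \<epsilon>0"
    using dist_sphere_eq[OF ab] pos by simp
  then have "sdist a b < \<epsilon>0"
    using cos_mono_less_eq[of \<epsilon>0 "sdist a b"] \<epsilon>0 sdist_bounds[OF ab] by simp
  then show "sdist a b < \<epsilon>" using \<epsilon>0 by simp
qed

lemma sphere_nbhd_sdist_less:
  assumes "B \<subseteq> sphere 0 1" "a \<in> sphere_nbhd B l" "l < r"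
  shows "\<exists>b\<in>B. sdist a b < r"
proof -
  have "Inf (sdist a ` B) < r" "sdist a ` B \<noteq> {}"
    using assms by (auto simp: sphere_nbhd_def sdist_set_def)
  then show ?thesis using cInf_lessD[of "sdist a ` B" r] by auto
qed

lemma sph_hausdorff_lessD:
  assumes "A \<subseteq> sphere 0 1" "A \<noteq> {}" "B \<subseteq> sphere 0 1" "B \<noteq> {}" "sph_hausdorff A B < r"
  shows "\<forall>a\<in>A. \<exists>b\<in>B. sdist a b < r" "\<forall>b\<in>B. \<exists>a\<in>A. sdist a b < r"
proof -
  have "A \<subseteq> sphere_nbhd B (sph_hausdorff A B)" "B \<subseteq> sphere_nbhd A (sph_hausdorff A B)"
    using sph_hausdorff_min(1)[OF assms(1-4)] by auto
  then show "\<forall>a\<in>A. \<exists>b\<in>B. sdist a b < r" "\<forall>b\<in>B. \<exists>a\<in>A. sdist a b < r"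
    using sphere_nbhd_sdist_less[OF assms(3) _ assms(5)] sphere_nbhd_sdist_less[OF assms(1) _ assms(5)]
    by (auto simp: subset_iff sdist_commute)
qed

lemma sph_hausdorff_le:
  assumes A: "A \<subseteq> sphere 0 1" "A \<noteq> {}" and B: "B \<subseteq> sphere 0 1" "B \<noteq> {}" and r: "0 \<le> r"
    and AB: "\<forall>a\<in>A. \<exists>b\<in>B. sdist a b \<le> r" and BA: "\<forall>b\<in>B. \<exists>a\<in>A. sdist a b \<le> r"
  shows "sph_hausdorff A B \<le> r"
proof -
  \<comment> \<open>Only radii up to \<open>pi\<close> compete in the minimum that defines
    \<open>sph_hausdorff\<close>.\<close>
  have nbhd: "X \<subseteq> sphere_nbhd Y (min r pi)"
    if X: "X \<subseteq> sphere 0 1" and Y: "Y \<subseteq> sphere 0 1" and XY: "\<forall>x\<in>X. \<exists>y\<in>Y. sdist x y \<le> r"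
    for X Y :: "'a set"
  proof
    fix x assume x: "x \<in> X"
    obtain y where y: "y \<in> Y" "sdist x y \<le> r" using XY x by blast
    have "sdist_set x Y \<le> sdist x y" "sdist x y \<le> pi"
      using x y X Y by (auto intro!: sdist_set_lower sdist_bounds)
    then show "x \<in> sphere_nbhd Y (min r pi)" using x y X by (auto simp: sphere_nbhd_def)
  qed
  have "A \<subseteq> sphere_nbhd B (min r pi)" "B \<subseteq> sphere_nbhd A (min r pi)"
    using nbhd A B AB BA by (auto simp: sdist_commute)
  then have "sph_hausdorff A B \<le> min r pi"
    by (intro sph_hausdorff_min(2)[OF A B]) (use r in simp)
  then show ?thesis by simp
qed

text \<open>Uniform continuity on a compact closed neighbourhood of \<open>K\<close> inside
  \<open>U\<close> lets \<open>y\<close> leave \<open>K\<close>, as is needed to compare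
  \<open>K\<close> with nearby bodies.\<close>

lemma uniformly_continuous_near_compact:
  fixes f :: "'a::heine_borel \<Rightarrow> 'b::metric_space"
  assumes K: "compact K" "K \<noteq> {}" "K \<subseteq> U" and U: "open U" "continuous_on U f" and \<epsilon>: "0 < \<epsilon>"
  obtains \<delta> where "0 < \<delta>" "\<And>x y. x \<in> K \<Longrightarrow> dist x y < \<delta> \<Longrightarrow> dist (f x) (f y) < \<epsilon>"
proof -
  obtain e where e: "0 < e" "{x. infdist x K \<le> e} \<subseteq> U"
    using compact_in_open_separated[OF K(2,1) U(1) K(3)] by metis
  have "uniformly_continuous_on {x. infdist x K \<le> e} f"
    using compact_infdist_le[OF K(2,1) e(1)] continuous_on_subset[OF U(2) e(2)]
    by (rule compact_uniformly_continuous[rotated])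
  then obtain d where d: "0 < d"
    "\<And>x y. infdist x K \<le> e \<Longrightarrow> infdist y K \<le> e \<Longrightarrow> dist y x < d \<Longrightarrow> dist (f y) (f x) < \<epsilon>"
    using \<epsilon> unfolding uniformly_continuous_on_def by fastforce
  show ?thesis
  proof
    show "0 < min d e" using d e by simp
    fix x y assume x: "x \<in> K" and xy: "dist x y < min d e"
    have "infdist x K \<le> e" using x e by simp
    moreover have "infdist y K \<le> e"
      using infdist_le[OF x, of y] xy by (simp add: dist_commute)
    ultimately show "dist (f x) (f y) < \<epsilon>" using d(2) xy by simp
  qed
qed


section \<open>Gnomonic projection\<close>

lemma linear_orth_proj:
  fixes V :: "'a::euclidean_space set"
  assumes V: "subspace V"
  shows "linear (orth_proj V)"
proof (rule linearI)
  show "orth_proj V (x + y) = orth_proj V x + orth_proj V y" for x y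
  proof (rule orth_proj_eqI[OF V])
    show "orth_proj V x + orth_proj V y \<in> V" using V orth_proj[OF V] by (simp add: subspace_add)
    show "orthogonal (x + y - (orth_proj V x + orth_proj V y)) w" if "w \<in> V" for w
      using orth_proj[OF V, of x] orth_proj[OF V, of y] that
      by (simp add: orthogonal_def add_diff_add inner_add_left)
  qed
qed (rule orth_proj_scaleR[OF V])

lemma orth_proj_compact_convex:
  assumes "subspace V" "K \<in> compact_convex_sets"
  shows "orth_proj V ` K \<in> compact_convex_sets"
  using compact_convex_setsD[OF assms(2)] linear_orth_proj[OF assms(1)]
  by (simp add: compact_convex_sets_def convex_linear_image compact_continuous_image
      linear_continuous_on linear_conv_bounded_linear)

lemma proper_bodiesD:
  assumes "K \<in> proper_bodies u"
  shows "K \<noteq> {}" "compact K" "convex (rad K)" "K \<subseteq> sphere 0 1" "K \<subseteq> {v. 0 < u \<bullet> v}"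
  using assms
  by (auto simp: proper_bodies_def sph_body_def sph_convex_def compact_eq_bounded_closed
      intro: bounded_subset[OF bounded_sphere])

text \<open>\<open>T\<close> is a linear isometry onto the orthogonal complement of
  \<open>u\<close>, so \<open>u + T x\<close> parametrises the tangent hyperplane at
  \<open>u\<close>.\<close>

locale gnomonic =
  fixes u :: "'b::euclidean_space" and T :: "'a::euclidean_space \<Rightarrow> 'b"
  assumes norm_u: "norm u = 1" and linear_T: "linear T"
    and inner_T: "T x \<bullet> T y = x \<bullet> y" and inner_u_T: "u \<bullet> T x = 0"
    and range_T: "u \<bullet> v = 0 \<Longrightarrow> v \<in> range T"
begin

text \<open>As \<open>T\<close> is isometric, its adjoint is a left inverse that vanishes at
  \<open>u\<close>.\<close>

definition coord :: "'b \<Rightarrow> 'a" where "coord = adjoint T"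

definition to_sphere :: "'a \<Rightarrow> 'b" where "to_sphere x = (1 / norm (u + T x)) *\<^sub>R (u + T x)"

definition chart :: "'b \<Rightarrow> 'a" where "chart v = (1 / (u \<bullet> v)) *\<^sub>R coord v"

lemma u_u [simp]: "u \<bullet> u = 1" using norm_u by (simp add: dot_square_norm)

lemma linear_coord: "linear coord"
  unfolding coord_def by (rule adjoint_linear[OF linear_T])

lemma inner_coord: "x \<bullet> coord v = T x \<bullet> v"
  unfolding coord_def by (rule adjoint_works[OF linear_T])

lemma coord_u [simp]: "coord u = 0"
  using inner_coord[of "coord u" u] inner_u_T by (simp add: inner_commute)

lemma coord_T [simp]: "coord (T x) = x"
proof -
  have "y \<bullet> coord (T x) = y \<bullet> x" for y by (simp add: inner_coord inner_T)
  then show ?thesis by (metis inner_commute vector_eq_rdot)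
qed

lemma T_coord: "v = (u \<bullet> v) *\<^sub>R u + T (coord v)"
proof -
  have "u \<bullet> (v - (u \<bullet> v) *\<^sub>R u) = 0" by (simp add: inner_diff_right)
  then obtain x where x: "v - (u \<bullet> v) *\<^sub>R u = T x" using range_T by blast
  then have v: "v = (u \<bullet> v) *\<^sub>R u + T x" by (simp add: algebra_simps)
  have "coord v = x"
    by (subst v) (simp add: linear_add[OF linear_coord] linear_scale[OF linear_coord])
  then show ?thesis using v by simp
qed

lemma u_lift [simp]: "u \<bullet> (u + T x) = 1" by (simp add: inner_add_right inner_u_T)

lemma norm_lift: "0 < norm (u + T x)"
  using u_lift[of x] by (metis inner_zero_right norm_le_zero_iff not_le zero_neq_one)

lemma u_to_sphere: "u \<bullet> to_sphere x = 1 / norm (u + T x)"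
  by (simp add: to_sphere_def)

lemma to_sphere_hemisphere: "to_sphere x \<in> sphere 0 1" "0 < u \<bullet> to_sphere x"
  using norm_lift[of x] by (simp_all add: to_sphere_def)

lemma coord_lift [simp]: "coord (u + T x) = x"
  by (simp add: linear_add[OF linear_coord])

lemma chart_to_sphere [simp]: "chart (to_sphere x) = x"
  using norm_lift[of x] unfolding chart_def u_to_sphere
  by (simp add: to_sphere_def linear_scale[OF linear_coord])

lemma lift_chart:
  assumes "0 < u \<bullet> v"
  shows "u + T (chart v) = (1 / (u \<bullet> v)) *\<^sub>R v"
proof -
  have "(1 / (u \<bullet> v)) *\<^sub>R v = (1 / (u \<bullet> v)) *\<^sub>R ((u \<bullet> v) *\<^sub>R u + T (coord v))"
    using T_coord[of v] by simp
  then show ?thesis using assms by (simp add: chart_def linear_scale[OF linear_T] scaleR_add_right)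
qed

lemma to_sphere_chart:
  assumes "v \<in> sphere 0 1" "0 < u \<bullet> v"
  shows "to_sphere (chart v) = v"
  using assms by (simp add: to_sphere_def lift_chart)

lemma chart_image_to_sphere [simp]: "chart ` to_sphere ` K = K"
  by (simp add: image_image)

lemma to_sphere_image_chart: "K \<in> proper_bodies u \<Longrightarrow> to_sphere ` chart ` K = K"
  using proper_bodiesD(4,5)[of K u] to_sphere_chart by (force simp: image_image)

lemma continuous_to_sphere: "continuous_on A to_sphere"
  unfolding to_sphere_def using norm_lift
  by (intro continuous_intros linear_continuous_on_compose[OF _ linear_T]) (metis less_irrefl)

lemma continuous_chart: "continuous_on {v. 0 < u \<bullet> v} chart"
  unfolding chart_def
  by (intro continuous_intros linear_continuous_on_compose[OF _ linear_coord]) auto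

lemma rad_to_sphere: "rad (to_sphere ` K) = conic hull ((\<lambda>x. u + T x) ` K)"
proof -
  have "\<exists>m\<ge>0. l *\<^sub>R to_sphere x = m *\<^sub>R (u + T x)" if "0 \<le> l" for l x
    using that norm_lift[of x] by (intro exI[of _ "l / norm (u + T x)"]) (simp add: to_sphere_def)
  moreover have "\<exists>m\<ge>0. l *\<^sub>R (u + T x) = m *\<^sub>R to_sphere x" if "0 \<le> l" for l x
    using that norm_lift[of x] by (intro exI[of _ "l * norm (u + T x)"]) (simp add: to_sphere_def)
  ultimately show ?thesis
    unfolding rad_def conic_hull_explicit by blast
qed

text \<open>The cone over the image is the conic hull of a translated linear image of
  \<open>K\<close>, hence convex.\<close>

lemma to_sphere_proper:
  assumes "K \<in> compact_convex_sets"
  shows "to_sphere ` K \<in> proper_bodies u"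
proof -
  note K = compact_convex_setsD[OF assms]
  have "closed (to_sphere ` K)"
    by (intro compact_imp_closed compact_continuous_image continuous_to_sphere K)
  moreover have "convex (rad (to_sphere ` K))"
  proof -
    have "(\<lambda>x. u + T x) ` K = (+) u ` T ` K" by (simp add: image_image)
    then show ?thesis unfolding rad_to_sphere
      by (simp add: convex_conic_hull convex_translation convex_linear_image K linear_T)
  qed
  ultimately show ?thesis
    using K to_sphere_hemisphere by (auto simp: proper_bodies_def sph_body_def sph_convex_def)
qed

lemma chart_compact_convex:
  assumes "K \<in> proper_bodies u"
  shows "chart ` K \<in> compact_convex_sets"
proof -
  note K = proper_bodiesD[OF assms]
  have "compact (chart ` K)"
    by (intro compact_continuous_image continuous_on_subset[OF continuous_chart] K)
  \<comment> \<open>The chart image is the slice of the cone by the tangent hyperplane, so it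
    inherits convexity from the cone.\<close>
  moreover have eq: "chart ` K = {x. u + T x \<in> rad K}"
  proof (intro equalityI subsetI)
    fix x assume "x \<in> chart ` K"
    then obtain v where v: "v \<in> K" "x = chart v" by blast
    then have "0 < u \<bullet> v" using K by auto
    then show "x \<in> {x. u + T x \<in> rad K}"
      using v by (auto simp: rad_def lift_chart intro!: exI[of _ "1 / (u \<bullet> v)"])
  next
    fix x assume "x \<in> {x. u + T x \<in> rad K}"
    then obtain l v where v: "u + T x = l *\<^sub>R v" "v \<in> K" by (auto simp: rad_def)
    have "l * (u \<bullet> v) = 1" using v(1) u_lift[of x] by simp
    then have "l = 1 / (u \<bullet> v)" by (auto simp: eq_divide_eq)
    moreover have "x = l *\<^sub>R coord v"
      using v(1) coord_lift[of x] by (simp add: linear_scale[OF linear_coord])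
    ultimately have "x = chart v" by (simp add: chart_def)
    then show "x \<in> chart ` K" using v by blast
  qed
  moreover have "convex (chart ` K)"
    unfolding eq
  proof (rule convexI)
    fix x y and s t :: real
    assume xy: "x \<in> {x. u + T x \<in> rad K}" "y \<in> {x. u + T x \<in> rad K}"
      and st: "0 \<le> s" "0 \<le> t" "s + t = 1"
    have "u + T (s *\<^sub>R x + t *\<^sub>R y) = (s + t) *\<^sub>R u + (s *\<^sub>R T x + t *\<^sub>R T y)"
      using st by (simp add: linear_add[OF linear_T] linear_scale[OF linear_T])
    also have "\<dots> = s *\<^sub>R (u + T x) + t *\<^sub>R (u + T y)" by (simp add: algebra_simps)
    also have "\<dots> \<in> rad K" using convexD[OF K(3)] xy st by simp
    finally show "s *\<^sub>R x + t *\<^sub>R y \<in> {x. u + T x \<in> rad K}" by simp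
  qed
  moreover have "chart ` K \<noteq> {}" using K(1) by simp
  ultimately show ?thesis unfolding compact_convex_sets_def by blast
qed

lemma orth_proj_lift:
  assumes V: "subspace V" "u \<in> V"
  shows "orth_proj V (l *\<^sub>R (u + T x)) = l *\<^sub>R (u + T (orth_proj (T -` V) x))"
proof -
  have W: "subspace (T -` V)" by (rule linear_subspace_vimage[OF linear_T V(1)])
  define y where "y = orth_proj (T -` V) x"
  have y: "T y \<in> V" "\<And>w. T w \<in> V \<Longrightarrow> (x - y) \<bullet> w = 0"
    using orth_proj[OF W, of x] by (auto simp: y_def orthogonal_def)
  have "orth_proj V (u + T x) = u + T y"
  proof (rule orth_proj_eqI[OF V(1)])
    show "u + T y \<in> V" using V y by (simp add: subspace_add)
    fix w assume w: "w \<in> V"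
    have "T (coord w) = w - (u \<bullet> w) *\<^sub>R u" using T_coord[of w] by (simp add: algebra_simps)
    then have "T (coord w) \<in> V" using V w by (simp add: subspace_diff subspace_scale)
    then have "T (x - y) \<bullet> T (coord w) = 0" using y by (simp add: inner_T)
    moreover have "T (x - y) \<bullet> u = 0" using inner_u_T by (simp add: inner_commute)
    moreover have "T (x - y) \<bullet> w = (u \<bullet> w) * (T (x - y) \<bullet> u) + T (x - y) \<bullet> T (coord w)"
      by (subst T_coord[of w]) (simp add: inner_add_right)
    ultimately have "T (x - y) \<bullet> w = 0" by simp
    then show "orthogonal (u + T x - (u + T y)) w"
      by (simp add: orthogonal_def linear_diff[OF linear_T])
  qed
  then show ?thesis by (simp add: orth_proj_scaleR[OF V(1)] y_def)
qed

text \<open>The projected cone consists of the rays through the projected points of the tangent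
  hyperplane, and each such ray meets the sphere in one point, its image under
  \<open>to_sphere\<close>.\<close>

lemma sph_proj_to_sphere:
  assumes V: "subspace V" "u \<in> V"
  shows "sph_proj (to_sphere ` K) (V \<inter> sphere 0 1) = to_sphere ` orth_proj (T -` V) ` K"
proof -
  define P where "P = orth_proj (T -` V)"
  have unit: "l *\<^sub>R (u + T x) \<in> sphere 0 1 \<longleftrightarrow> l *\<^sub>R (u + T x) = to_sphere x" if "0 \<le> l" for l x
  proof
    assume "l *\<^sub>R (u + T x) \<in> sphere 0 1"
    then have "l * norm (u + T x) = 1"
      using that by (simp del: scaleR_add_right)
    then have "l = 1 / norm (u + T x)" by (auto simp: eq_divide_eq)
    then show "l *\<^sub>R (u + T x) = to_sphere x" by (simp add: to_sphere_def)
  next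
    assume "l *\<^sub>R (u + T x) = to_sphere x"
    then show "l *\<^sub>R (u + T x) \<in> sphere 0 1" using to_sphere_hemisphere(1)[of x] by simp
  qed
  have cone: "{c *\<^sub>R x |c x. 0 \<le> c \<and> x \<in> h ` K} = (\<lambda>(l, x). l *\<^sub>R h x) ` ({0..} \<times> K)"
    for h :: "'a \<Rightarrow> 'b" by auto
  have "sph_proj (to_sphere ` K) (V \<inter> sphere 0 1) =
      (\<lambda>(l, x). l *\<^sub>R (u + T (P x))) ` ({0..} \<times> K) \<inter> sphere 0 1"
    unfolding sph_proj_def span_sphere_section[OF V(1)] rad_to_sphere conic_hull_explicit cone
    by (simp add: image_image case_prod_unfold P_def orth_proj_lift[OF V] del: scaleR_add_right)
  also have "\<dots> = to_sphere ` P ` K"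
  proof (intro equalityI subsetI)
    fix v assume "v \<in> (\<lambda>(l, x). l *\<^sub>R (u + T (P x))) ` ({0..} \<times> K) \<inter> sphere 0 1"
    then obtain l x where "v = l *\<^sub>R (u + T (P x))" "0 \<le> l" "x \<in> K" "v \<in> sphere 0 1"
      by auto
    then show "v \<in> to_sphere ` P ` K" using unit by auto
  next
    fix v assume "v \<in> to_sphere ` P ` K"
    then obtain x where "x \<in> K" "v = to_sphere (P x)" by blast
    then show "v \<in> (\<lambda>(l, x). l *\<^sub>R (u + T (P x))) ` ({0..} \<times> K) \<inter> sphere 0 1"
      using to_sphere_hemisphere(1)[of "P x"] norm_lift[of "P x"]
      by (intro IntI image_eqI[of _ _ "(1 / norm (u + T (P x)), x)"]) (auto simp: to_sphere_def)
  qed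
  finally show ?thesis by (simp add: P_def)
qed

section \<open>Conjugation of operations with the gnomonic projection\<close>

definition to_flat_op :: "('b set \<times> 'b set \<Rightarrow> 'b set) \<Rightarrow> 'a set \<times> 'a set \<Rightarrow> 'a set" where
  "to_flat_op f = restrict (\<lambda>(K, L). chart ` f (to_sphere ` K, to_sphere ` L))
    (compact_convex_sets \<times> compact_convex_sets)"

definition to_sphere_op :: "('a set \<times> 'a set \<Rightarrow> 'a set) \<Rightarrow> 'b set \<times> 'b set \<Rightarrow> 'b set" where
  "to_sphere_op g = restrict (\<lambda>(K, L). to_sphere ` g (chart ` K, chart ` L))
    (proper_bodies u \<times> proper_bodies u)"

lemma to_flat_op_covariant:
  assumes f: "f \<in> sph_proj_covariant_ops u"
  shows "to_flat_op f \<in> proj_covariant_ops"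
proof -
  have f_mem: "f (K, L) \<in> proper_bodies u" if "K \<in> proper_bodies u" "L \<in> proper_bodies u" for K L
    using f that by (auto simp: sph_proj_covariant_ops_def)
  have f_proj: "f (sph_proj K S, sph_proj L S) = sph_proj (f (K, L)) S"
    if "k + 1 < DIM('b)" "k_sphere k S" "u \<in> S" "K \<in> proper_bodies u" "L \<in> proper_bodies u" for k S K L
    using f that unfolding sph_proj_covariant_ops_def by blast
  have mem: "to_flat_op f (K, L) \<in> compact_convex_sets"
    if "K \<in> compact_convex_sets" "L \<in> compact_convex_sets" for K L
    using that by (simp add: to_flat_op_def chart_compact_convex f_mem to_sphere_proper)
  have "to_flat_op f (orth_proj W ` K, orth_proj W ` L) = orth_proj W ` to_flat_op f (K, L)"
    if W: "subspace W" and K: "K \<in> compact_convex_sets" and L: "L \<in> compact_convex_sets" for W K L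
  proof (cases "W = UNIV")
    case True
    then show ?thesis by (simp add: orth_proj_ident)
  next
    case False
    define V where "V = coord -` W"
    define S where "S = V \<inter> sphere 0 1"
    have V: "subspace V" "u \<in> V" "T -` V = W"
      using linear_subspace_vimage[OF linear_coord W] subspace_0[OF W] by (auto simp: V_def)
    have "V \<noteq> UNIV" using False V(3) by auto
    then have dimV: "dim V < DIM('b)"
      using V(1) dim_eq_full[of V] dim_subset_UNIV[of V] by (metis order_le_less span_eq_iff)
    have "dim V \<noteq> 0" using V(2) norm_u by auto
    \<comment> \<open>A \<open>k\<close>-sphere comes from dimension \<open>k + 1\<close>; the
      subtraction on naturals is harmless because \<open>u\<close> is a nonzero vector of
      \<open>V\<close>.\<close>
    then have d: "dim V - 1 + 1 = dim V" by linarith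
    have S: "k_sphere (dim V - 1) S" "dim V - 1 + 1 < DIM('b)" "u \<in> S"
      unfolding k_sphere_def d using V dimV norm_u by (auto simp: S_def)
    note proper = to_sphere_proper[OF K] to_sphere_proper[OF L]
    have "to_flat_op f (orth_proj W ` K, orth_proj W ` L) =
        chart ` f (sph_proj (to_sphere ` K) S, sph_proj (to_sphere ` L) S)"
      using K L W by (simp add: to_flat_op_def orth_proj_compact_convex S_def sph_proj_to_sphere V)
    also have "\<dots> = chart ` sph_proj (f (to_sphere ` K, to_sphere ` L)) S"
      using f_proj[OF S(2,1,3) proper] by simp
    also have "f (to_sphere ` K, to_sphere ` L) = to_sphere ` to_flat_op f (K, L)"
      using K L by (simp add: to_flat_op_def to_sphere_image_chart f_mem proper)
    finally show ?thesis by (simp add: S_def sph_proj_to_sphere V)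
  qed
  moreover have "to_flat_op f \<in> (compact_convex_sets \<times> compact_convex_sets) \<rightarrow>\<^sub>E compact_convex_sets"
    using mem by (auto simp: PiE_def to_flat_op_def)
  ultimately show ?thesis unfolding proj_covariant_ops_def by blast
qed

lemma to_sphere_op_covariant:
  assumes g: "g \<in> proj_covariant_ops"
  shows "to_sphere_op g \<in> sph_proj_covariant_ops u"
proof -
  have g_mem: "g (K, L) \<in> compact_convex_sets"
    if "K \<in> compact_convex_sets" "L \<in> compact_convex_sets" for K L
    using g that by (auto simp: proj_covariant_ops_def)
  have g_proj: "g (orth_proj W ` K, orth_proj W ` L) = orth_proj W ` g (K, L)"
    if "subspace W" "K \<in> compact_convex_sets" "L \<in> compact_convex_sets" for W K L
    using g that unfolding proj_covariant_ops_def by blast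
  have mem: "to_sphere_op g (K, L) \<in> proper_bodies u"
    if "K \<in> proper_bodies u" "L \<in> proper_bodies u" for K L
    using that by (simp add: to_sphere_op_def to_sphere_proper g_mem chart_compact_convex)
  have "to_sphere_op g (sph_proj K S, sph_proj L S) = sph_proj (to_sphere_op g (K, L)) S"
    if S: "k_sphere k S" "u \<in> S" and K: "K \<in> proper_bodies u" and L: "L \<in> proper_bodies u" for k S K L
  proof -
    obtain V where V: "subspace V" "S = V \<inter> sphere 0 1" using S(1) by (auto simp: k_sphere_def)
    have uV: "u \<in> V" using S V by simp
    define P where "P = orth_proj (T -` V)"
    have W: "subspace (T -` V)" by (rule linear_subspace_vimage[OF linear_T V(1)])
    have proj: "sph_proj M S = to_sphere ` P ` chart ` M" if "M \<in> proper_bodies u" for M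
      using sph_proj_to_sphere[OF V(1) uV, of "chart ` M"] to_sphere_image_chart[OF that]
      by (simp add: V(2) P_def)
    have proper: "sph_proj M S \<in> proper_bodies u" if "M \<in> proper_bodies u" for M
      using that
      by (simp add: proj P_def to_sphere_proper orth_proj_compact_convex[OF W] chart_compact_convex)
    have "to_sphere_op g (sph_proj K S, sph_proj L S) = to_sphere ` g (P ` chart ` K, P ` chart ` L)"
      using proper[OF K] proper[OF L] by (simp add: to_sphere_op_def proj K L)
    also have "\<dots> = to_sphere ` P ` g (chart ` K, chart ` L)"
      using g_proj[OF W chart_compact_convex[OF K] chart_compact_convex[OF L]] by (simp add: P_def)
    also have "\<dots> = sph_proj (to_sphere_op g (K, L)) S"
      using proj[OF mem[OF K L]] K L by (simp add: to_sphere_op_def)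
    finally show ?thesis .
  qed
  moreover have "to_sphere_op g \<in> (proper_bodies u \<times> proper_bodies u) \<rightarrow>\<^sub>E proper_bodies u"
    using mem by (auto simp: PiE_def to_sphere_op_def)
  ultimately show ?thesis unfolding sph_proj_covariant_ops_def by blast
qed

lemma to_sphere_op_to_flat_op:
  assumes f: "f \<in> sph_proj_covariant_ops u"
  shows "to_sphere_op (to_flat_op f) = f"
proof (rule extensionalityI)
  show "to_sphere_op (to_flat_op f) \<in> extensional (proper_bodies u \<times> proper_bodies u)"
    by (simp add: to_sphere_op_def)
  show "f \<in> extensional (proper_bodies u \<times> proper_bodies u)"
    using f by (simp add: sph_proj_covariant_ops_def PiE_def)
  fix p assume p: "p \<in> proper_bodies u \<times> proper_bodies u"
  have "f p \<in> proper_bodies u" using f p by (auto simp: sph_proj_covariant_ops_def)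
  then have "to_sphere ` chart ` f p = f p" by (rule to_sphere_image_chart)
  with p show "to_sphere_op (to_flat_op f) p = f p"
    by (cases p) (simp add: to_sphere_op_def to_flat_op_def chart_compact_convex to_sphere_image_chart)
qed

lemma to_flat_op_to_sphere_op:
  assumes g: "g \<in> proj_covariant_ops"
  shows "to_flat_op (to_sphere_op g) = g"
proof (rule extensionalityI)
  show "to_flat_op (to_sphere_op g) \<in> extensional (compact_convex_sets \<times> compact_convex_sets)"
    by (simp add: to_flat_op_def)
  show "g \<in> extensional (compact_convex_sets \<times> compact_convex_sets)"
    using g by (simp add: proj_covariant_ops_def PiE_def)
  show "to_flat_op (to_sphere_op g) p = g p" if "p \<in> compact_convex_sets \<times> compact_convex_sets" for p
    using that by (auto simp: to_sphere_op_def to_flat_op_def to_sphere_proper)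
qed

lemma bij_betw_to_flat_op:
  "bij_betw to_flat_op (sph_proj_covariant_ops u) proj_covariant_ops"
  by (rule bij_betwI[where g = to_sphere_op])
    (auto simp: to_flat_op_covariant to_sphere_op_covariant to_sphere_op_to_flat_op
      to_flat_op_to_sphere_op)

section \<open>Transfer of continuity to the sphere\<close>

lemma chart_hausdorff_le:
  assumes K: "K \<in> proper_bodies u" and \<epsilon>: "0 < \<epsilon>"
  obtains \<delta> where "0 < \<delta>" "\<And>K'. K' \<in> proper_bodies u \<Longrightarrow> sph_hausdorff K K' < \<delta> \<Longrightarrow>
    hausdorff_le \<epsilon> (chart ` K) (chart ` K')"
proof -
  note Kd = proper_bodiesD[OF K]
  have "open {v. 0 < u \<bullet> v}" by (intro open_Collect_less continuous_intros)
  \<comment> \<open>The chart is unbounded near the boundary of the hemisphere, so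
    \<open>\<delta>\<close> has to depend on \<open>K\<close>.\<close>
  then obtain \<delta> where \<delta>: "0 < \<delta>" "\<And>v w. v \<in> K \<Longrightarrow> dist v w < \<delta> \<Longrightarrow> dist (chart v) (chart w) < \<epsilon>"
    using uniformly_continuous_near_compact[OF Kd(2,1,5) _ continuous_chart \<epsilon>] by blast
  have "hausdorff_le \<epsilon> (chart ` K) (chart ` K')"
    if K': "K' \<in> proper_bodies u" and less: "sph_hausdorff K K' < \<delta>" for K'
  proof -
    note Kd' = proper_bodiesD[OF K']
    have close: "dist (chart v) (chart w) \<le> \<epsilon>" if "v \<in> K" "w \<in> K'" "sdist v w < \<delta>" for v w
      using \<delta>(2)[of v w] dist_le_sdist[of v w] that Kd(4) Kd'(4) by force
    show ?thesis
      unfolding hausdorff_le_def ball_simps bex_simps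
      using sph_hausdorff_lessD[OF Kd(4,1) Kd'(4,1) less] close by blast
  qed
  then show ?thesis using \<delta>(1) that by blast
qed

lemma to_sphere_hausdorff_less:
  assumes A: "A \<in> compact_convex_sets" and \<epsilon>: "0 < \<epsilon>"
  obtains \<delta> where "0 < \<delta>" "\<And>A'. A' \<in> compact_convex_sets \<Longrightarrow> hausdorff_le \<delta> A A' \<Longrightarrow>
    sph_hausdorff (to_sphere ` A) (to_sphere ` A') < \<epsilon>"
proof -
  note Ad = compact_convex_setsD[OF A]
  obtain \<eta> where \<eta>: "0 < \<eta>" "\<And>a b :: 'b. a \<in> sphere 0 1 \<Longrightarrow> b \<in> sphere 0 1 \<Longrightarrow> dist a b < \<eta> \<Longrightarrow>
      sdist a b < \<epsilon> / 2"
    \<comment> \<open>Half of \<open>\<epsilon>\<close> leaves room for the strict inequality after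
      passing to the nonstrict bound on the Hausdorff distance.\<close>
    using sdist_small[of "\<epsilon> / 2"] \<epsilon> by (metis half_gt_zero)
  obtain \<delta> where \<delta>: "0 < \<delta>" "\<And>x y. x \<in> A \<Longrightarrow> dist x y < \<delta> \<Longrightarrow> dist (to_sphere x) (to_sphere y) < \<eta>"
    using uniformly_continuous_near_compact[OF Ad(2,1) subset_UNIV open_UNIV continuous_to_sphere \<eta>(1)]
    by blast
  have close: "sdist (to_sphere x) (to_sphere y) \<le> \<epsilon> / 2" if "x \<in> A" "dist x y \<le> \<delta> / 2" for x y
    using \<eta>(2)[OF to_sphere_hemisphere(1) to_sphere_hemisphere(1) \<delta>(2)[of x y]] that \<delta>(1) by simp
  have "sph_hausdorff (to_sphere ` A) (to_sphere ` A') < \<epsilon>"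
    if A': "A' \<in> compact_convex_sets" and near: "hausdorff_le (\<delta> / 2) A A'" for A'
  proof -
    have "sph_hausdorff (to_sphere ` A) (to_sphere ` A') \<le> \<epsilon> / 2"
    proof (rule sph_hausdorff_le)
      show "\<forall>a\<in>to_sphere ` A. \<exists>b\<in>to_sphere ` A'. sdist a b \<le> \<epsilon> / 2"
        using near close unfolding hausdorff_le_def by blast
      show "\<forall>b\<in>to_sphere ` A'. \<exists>a\<in>to_sphere ` A. sdist a b \<le> \<epsilon> / 2"
        using near close unfolding hausdorff_le_def by blast
    qed (use compact_convex_setsD[OF A'] Ad \<epsilon> to_sphere_hemisphere in auto)
    then show ?thesis using \<epsilon> by simp
  qed
  then show ?thesis using \<delta>(1) that[of "\<delta> / 2"] by auto
qed

text \<open>The operation is a composition of chart, flat operation and return to the sphere. Each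
  factor is continuous at the bodies in question, and the tolerances are chosen from the last factor
  back to the first.\<close>

lemma continuous_map_sph_op:
  assumes f: "f \<in> sph_proj_covariant_ops u" and dim: "2 \<le> DIM('a)"
  shows "continuous_map (prod_topology (proper_bodies_topology u) (proper_bodies_topology u))
    (proper_bodies_topology u) f"
proof -
  interpret flat: proj_covariant_op "to_flat_op f"
    by unfold_locales (use to_flat_op_covariant[OF f] dim in auto)
  interpret M: Metric_space "proper_bodies u" sph_hausdorff by (rule Metric_space_proper_bodies)
  interpret MM: Metric_space12 "proper_bodies u" sph_hausdorff "proper_bodies u" sph_hausdorff
    by unfold_locales
  have f_eq: "f (K, L) = to_sphere ` to_flat_op f (chart ` K, chart ` L)"
    if "K \<in> proper_bodies u" "L \<in> proper_bodies u" for K L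
    using arg_cong[OF to_sphere_op_to_flat_op[OF f], of "\<lambda>h. h (K, L)"] that
    by (simp add: to_sphere_op_def)
  have "\<exists>\<delta>>0. \<forall>q. q \<in> proper_bodies u \<times> proper_bodies u \<and>
      prod_dist sph_hausdorff sph_hausdorff p q < \<delta> \<longrightarrow> sph_hausdorff (f p) (f q) < \<epsilon>"
    if p: "p \<in> proper_bodies u \<times> proper_bodies u" and \<epsilon>: "0 < \<epsilon>" for p and \<epsilon> :: real
  proof -
    obtain K L where pe: "p = (K, L)" and K: "K \<in> proper_bodies u" and L: "L \<in> proper_bodies u"
      using p by auto
    note KL = chart_compact_convex[OF K] chart_compact_convex[OF L]
    obtain \<eta> where \<eta>: "0 < \<eta>" "\<And>A'. A' \<in> compact_convex_sets \<Longrightarrow>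
        hausdorff_le \<eta> (to_flat_op f (chart ` K, chart ` L)) A' \<Longrightarrow>
        sph_hausdorff (to_sphere ` to_flat_op f (chart ` K, chart ` L)) (to_sphere ` A') < \<epsilon>"
      using to_sphere_hausdorff_less[OF flat.closed_op[OF KL] \<epsilon>] by blast
    obtain \<gamma> where \<gamma>: "0 < \<gamma>" "\<And>A' B'. A' \<in> compact_convex_sets \<Longrightarrow> B' \<in> compact_convex_sets \<Longrightarrow>
        hausdorff_le \<gamma> (chart ` K) A' \<Longrightarrow> hausdorff_le \<gamma> (chart ` L) B' \<Longrightarrow>
        hausdorff_le \<eta> (to_flat_op f (chart ` K, chart ` L)) (to_flat_op f (A', B'))"
      using flat.op_continuous[OF KL \<eta>(1)] by blast
    obtain \<delta>1 where \<delta>1: "0 < \<delta>1" "\<And>K'. K' \<in> proper_bodies u \<Longrightarrow> sph_hausdorff K K' < \<delta>1 \<Longrightarrow>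
        hausdorff_le \<gamma> (chart ` K) (chart ` K')"
      using chart_hausdorff_le[OF K \<gamma>(1)] by blast
    obtain \<delta>2 where \<delta>2: "0 < \<delta>2" "\<And>L'. L' \<in> proper_bodies u \<Longrightarrow> sph_hausdorff L L' < \<delta>2 \<Longrightarrow>
        hausdorff_le \<gamma> (chart ` L) (chart ` L')"
      using chart_hausdorff_le[OF L \<gamma>(1)] by blast
    have "sph_hausdorff (f p) (f (K', L')) < \<epsilon>"
      if K': "K' \<in> proper_bodies u" and L': "L' \<in> proper_bodies u"
        and less: "prod_dist sph_hausdorff sph_hausdorff p (K', L') < min \<delta>1 \<delta>2" for K' L'
    proof -
      have "sph_hausdorff K K' < \<delta>1" "sph_hausdorff L L' < \<delta>2"
        using less MM.component_le_prod_metric(1)[of K K' L L']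
          MM.component_le_prod_metric(2)[of L L' K K'] by (auto simp: pe)
      then show ?thesis
        unfolding pe f_eq[OF K L] f_eq[OF K' L']
        by (intro \<eta>(2) \<gamma>(2) \<delta>1(2) \<delta>2(2) flat.closed_op chart_compact_convex K' L')
    qed
    moreover have "0 < min \<delta>1 \<delta>2" using \<delta>1 \<delta>2 by simp
    ultimately show ?thesis by (metis mem_Times_iff prod.collapse)
  qed
  moreover have "f ` (proper_bodies u \<times> proper_bodies u) \<subseteq> proper_bodies u"
    using f by (auto simp: sph_proj_covariant_ops_def)
  ultimately show ?thesis
    \<comment> \<open>The product topology is induced by the product metric, so the estimate at each
      point \<open>p\<close> is all that continuity requires.\<close>
    unfolding proper_bodies_topology_def MM.mtopology_prod_metric[symmetric]
      MM.Prod_metric.metric_continuous_map[OF Metric_space_proper_bodies]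
    by blast
qed

end

text \<open>The complement of \<open>u\<close> has the dimension of the flat space, and subspaces of
  equal dimension are linearly isometric.\<close>

lemma gnomonic_exists:
  fixes u :: "'b::euclidean_space"
  assumes "norm u = 1" "DIM('b) = DIM('a) + 1"
  obtains T :: "'a::euclidean_space \<Rightarrow> 'b" where "gnomonic u T"
proof -
  have "u \<noteq> 0" using assms by auto
  then have "dim (UNIV :: 'a set) = dim {v. u \<bullet> v = 0}"
    using assms by (simp add: dim_hyperplane)
  then obtain T :: "'a \<Rightarrow> 'b" where T: "linear T" "T ` UNIV = {v. u \<bullet> v = 0}" "\<And>x. norm (T x) = norm x"
    using isometries_subspaces[OF subspace_UNIV subspace_hyperplane[of u]] by (metis UNIV_I)
  \<comment> \<open>Polarisation: a linear map that preserves norms preserves inner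
    products.\<close>
  then have inner_eq: "T x \<bullet> T y = x \<bullet> y" for x y
    by (simp add: dot_norm flip: linear_add[OF T(1)])
  then have "gnomonic u T"
    using T assms by (intro gnomonic.intro) auto
  then show ?thesis by (rule that)
qed

theorem theorem2:
  fixes u :: "real ^ 'm"
  assumes "CARD('n::finite) \<ge> 2" and "CARD('m) = CARD('n) + 1" and "u \<in> sphere 0 1"
  shows "(\<exists>\<Phi>. bij_betw \<Phi> (sph_proj_covariant_ops u)
            (proj_covariant_ops :: ((real ^ 'n) set \<times> (real ^ 'n) set \<Rightarrow> (real ^ 'n) set) set)) \<and>
         (\<forall>f \<in> sph_proj_covariant_ops u.
            continuous_map (prod_topology (proper_bodies_topology u) (proper_bodies_topology u))
              (proper_bodies_topology u) f)"
proof -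
  obtain T :: "real ^ 'n \<Rightarrow> real ^ 'm" where "gnomonic u T"
    using gnomonic_exists[of u, where ?'a = "real ^ 'n"] assms by auto
  then interpret gnomonic u T .
  show ?thesis
    using bij_betw_to_flat_op continuous_map_sph_op assms(1) by auto
qed

end
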